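(* Let $\mathbb{F}$ be a field with $|\mathbb{F}|>2$ and $\operatorname{char}\mathbb{F}=2$, let $n\ge 3$, and let $V$ be an $n$-dimensional $\mathbb{F}$-vector space, $G=GL(V)$. (i) $\mathcal{K}$ is the only maximal $G$-submodule of $\mathcal{C}$ other than $\mathcal{N}$ (which is also maximal), and $\mathcal{C}/\mathcal{K}$ and $\mathcal{N}/\mathcal{U}$ are irreducible $G$-modules. (ii) If $n$ is odd, then $\mathcal{C}$ has precisely two composition series, namely $0\subset\mathcal{M}^{\ast}_{(1,1)}\subset\mathcal{U}\subset\mathcal{K}\subset\mathcal{C}$ and $0\subset\mathcal{M}^{\ast}_{(1,1)}\subset\mathcal{U}\subset\mathcal{N}\subset\mathcal{C}$. If $n$ is even, then $\mathcal{C}$ has precisely three composition series: two of them obtained by refining the first factor of the filtration $0\subset\mathcal{K}\subset\mathcal{C}$, where $\mathcal{K}=\mathcal{U}\oplus\mathcal{M}^{\ast}_{(1,1)}$ is a direct sum of two irreducible $G$-modules (that is, $0\subset\mathcal{U}\subset\mathcal{K}\subset\mathcal{C}$ and $0\subset\mathcal{M}^{\ast}_{(1,1)}\subset\mathcal{K}\subset\mathcal{C}$), the third one being $0\subset\mathcal{U}\subset\mathcal{N}\subset\mathcal{C}$.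
   Context: $V$ is an $n$-dimensional vector space over $\mathbb{F}$ with a fixed basis $v_1,\dots,v_n$; $G=GL(V)$ acts on $V$ on the left; $\widehat V$ is the dual space of $V$. $\boldsymbol{\Lambda}=\mathbb{F}^{n^3}$ is the space of structure vectors $\boldsymbol{\lambda}=(\lambda_{ijk})_{1\le i,j,k\le n}$; such a vector corresponds to the (not necessarily associative) algebra on $V$ whose bilinear product is $[v_i,v_j]=\sum_k\lambda_{ijk}v_k$. $G$ acts linearly on $\boldsymbol{\Lambda}$ on the right: $\boldsymbol{\lambda}g$ is the structure vector of the product $[u,v]'=g^{-1}[gu,gv]$. $G$-submodules of $\boldsymbol{\Lambda}$ are with respect to this action. Define the following $G$-submodules of $\boldsymbol{\Lambda}$ (where $[\,,\,]$ is the product with structure vector $\boldsymbol{\lambda}$): $\mathcal{C}$ = all $\boldsymbol{\lambda}$ with $[u,v]=[v,u]$ for all $u,v\in V$; $\mathcal{K}$ = all $\boldsymbol{\lambda}$ with $[v,v]=0$ for all $v\in V$ (in characteristic 2, $\mathcal{K}\subset\mathcal{C}$); $\mathcal{T}$ = all $\boldsymbol{\lambda}$ such that for every $u\in V$ the linear map $v\mapsto[u,v]$ has trace $0$; $\mathcal{U}=\mathcal{K}\cap\mathcal{T}$ and $\mathcal{N}=\mathcal{C}\cap\mathcal{T}$; $\mathcal{M}^{\ast}_{(1,1)}$ = all structure vectors of products of the form $[u,v]=\theta(v)u+\theta(u)v$ with $\theta\in\widehat V$. *)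

theory Defs
  imports "HOL-Analysis.Analysis"
begin

text \<open>
  The module axioms are not part of the record: it only serves for the structure-vector module
  below, its submodules and their quotients, which satisfy them. The field \<open>gm_act\<close> takes the vector first,
  because the actions considered below are right actions.
\<close>

record ('f, 'g, 'm) gmodule =
  gm_carrier :: "'m set"
  gm_zero :: 'm
  gm_add :: "'m \<Rightarrow> 'm \<Rightarrow> 'm"
  gm_scale :: "'f \<Rightarrow> 'm \<Rightarrow> 'm"
  gm_group :: "'g set"
  gm_act :: "'m \<Rightarrow> 'g \<Rightarrow> 'm"

definition gm_submodule :: "('f, 'g, 'm) gmodule \<Rightarrow> 'm set \<Rightarrow> bool" where
  "gm_submodule M W \<longleftrightarrow>
     W \<subseteq> gm_carrier M \<and> gm_zero M \<in> W \<and>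
     (\<forall>x\<in>W. \<forall>y\<in>W. gm_add M x y \<in> W) \<and>
     (\<forall>c. \<forall>x\<in>W. gm_scale M c x \<in> W) \<and>
     (\<forall>g\<in>gm_group M. \<forall>x\<in>W. gm_act M x g \<in> W)"

definition gm_restrict :: "('f, 'g, 'm) gmodule \<Rightarrow> 'm set \<Rightarrow> ('f, 'g, 'm) gmodule" where
  "gm_restrict M W = M\<lparr>gm_carrier := W\<rparr>"

text \<open>
  The quotient by a submodule \<open>W\<close>, with the cosets \<open>x + W\<close> as elements. In the scalar
  multiplication, \<open>W\<close> is added once more so that \<open>0 (x + W)\<close> is \<open>W\<close> and not just \<open>{0}\<close>.
\<close>

definition gm_quotient :: "('f, 'g, 'm) gmodule \<Rightarrow> 'm set \<Rightarrow> ('f, 'g, 'm set) gmodule" where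
  "gm_quotient M W =
     \<lparr>gm_carrier = {{gm_add M x w | w. w \<in> W} | x. x \<in> gm_carrier M},
      gm_zero = W,
      gm_add = (\<lambda>A B. {gm_add M a b | a b. a \<in> A \<and> b \<in> B}),
      gm_scale = (\<lambda>c A. {gm_add M (gm_scale M c a) w | a w. a \<in> A \<and> w \<in> W}),
      gm_group = gm_group M,
      gm_act = (\<lambda>A g. {gm_act M a g | a. a \<in> A})\<rparr>"

definition gm_irreducible :: "('f, 'g, 'm) gmodule \<Rightarrow> bool" where
  "gm_irreducible M \<longleftrightarrow>
     gm_carrier M \<noteq> {gm_zero M} \<and>
     (\<forall>W. gm_submodule M W \<longrightarrow> W = {gm_zero M} \<or> W = gm_carrier M)"

definition gm_maximal_submodule :: "('f, 'g, 'm) gmodule \<Rightarrow> 'm set \<Rightarrow> bool" where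
  "gm_maximal_submodule M W \<longleftrightarrow>
     gm_submodule M W \<and> W \<noteq> gm_carrier M \<and>
     (\<forall>W'. gm_submodule M W' \<and> W \<subseteq> W' \<longrightarrow> W' = W \<or> W' = gm_carrier M)"

definition gm_composition_series :: "('f, 'g, 'm) gmodule \<Rightarrow> 'm set list \<Rightarrow> bool" where
  "gm_composition_series M Ws \<longleftrightarrow>
     Ws \<noteq> [] \<and> hd Ws = {gm_zero M} \<and> last Ws = gm_carrier M \<and>
     (\<forall>W\<in>set Ws. gm_submodule M W) \<and>
     (\<forall>i. Suc i < length Ws \<longrightarrow>
        Ws ! i \<subset> Ws ! Suc i \<and>
        gm_irreducible (gm_quotient (gm_restrict M (Ws ! Suc i)) (Ws ! i)))"

definition gm_direct_sum :: "('f, 'g, 'm) gmodule \<Rightarrow> 'm set \<Rightarrow> 'm set \<Rightarrow> bool" where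
  "gm_direct_sum M A B \<longleftrightarrow>
     gm_submodule M A \<and> gm_submodule M B \<and>
     gm_carrier M = {gm_add M a b | a b. a \<in> A \<and> b \<in> B} \<and> A \<inter> B = {gm_zero M}"

text \<open>
  The basis is indexed by a finite type \<open>'n\<close> instead of \<open>{1..n}\<close>; the dimension is
  \<open>CARD('n)\<close>. Structure vectors are the elements of \<open>'f ^ ('n \<times> 'n \<times> 'n)\<close>.
\<close>

locale based_space = vector_space scale
  for scale :: "'f::field \<Rightarrow> 'v::ab_group_add \<Rightarrow> 'v" (infixr \<open>*v*\<close> 75) +
  fixes v :: "'n::finite \<Rightarrow> 'v"
  assumes inj_basis: "inj v"
    and independent_basis: "independent (range v)"
    and span_basis: "span (range v) = UNIV"
begin

definition coord :: "'v \<Rightarrow> 'n \<Rightarrow> 'f" where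
  "coord x i = representation (range v) x (v i)"

definition linear_trace :: "('v \<Rightarrow> 'v) \<Rightarrow> 'f" where
  "linear_trace f = trace (\<chi> i j. coord (f (v j)) i)"

definition dual :: "('v \<Rightarrow> 'f) set" where
  "dual = {\<theta>. Vector_Spaces.linear scale (*) \<theta>}"

definition GL :: "('v \<Rightarrow> 'v) set" where
  "GL = {g. Vector_Spaces.linear scale scale g \<and> bij g}"

definition product :: "'f ^ ('n \<times> 'n \<times> 'n) \<Rightarrow> 'v \<Rightarrow> 'v \<Rightarrow> 'v" where
  "product l x y =
     (\<Sum>i\<in>UNIV. \<Sum>j\<in>UNIV. (coord x i * coord y j) *v* (\<Sum>k\<in>UNIV. l $ (i, j, k) *v* v k))"

definition structure_vector :: "('v \<Rightarrow> 'v \<Rightarrow> 'v) \<Rightarrow> 'f ^ ('n \<times> 'n \<times> 'n)" where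
  "structure_vector p = vec_lambda (\<lambda>(i, j, k). coord (p (v i) (v j)) k)"

definition Lambda :: "('f, 'v \<Rightarrow> 'v, 'f ^ ('n \<times> 'n \<times> 'n)) gmodule" where
  "Lambda =
     \<lparr>gm_carrier = UNIV, gm_zero = 0, gm_add = (+), gm_scale = (*s), gm_group = GL,
      gm_act = (\<lambda>l g. structure_vector (\<lambda>x y. inv g (product l (g x) (g y))))\<rparr>"

definition C :: "('f ^ ('n \<times> 'n \<times> 'n)) set" where
  "C = {l. \<forall>x y. product l x y = product l y x}"

definition K :: "('f ^ ('n \<times> 'n \<times> 'n)) set" where
  "K = {l. \<forall>x. product l x x = 0}"

definition T :: "('f ^ ('n \<times> 'n \<times> 'n)) set" where
  "T = {l. \<forall>x. linear_trace (product l x) = 0}"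

definition U :: "('f ^ ('n \<times> 'n \<times> 'n)) set" where
  "U = K \<inter> T"

definition N :: "('f ^ ('n \<times> 'n \<times> 'n)) set" where
  "N = C \<inter> T"

definition Mstar11 :: "('f ^ ('n \<times> 'n \<times> 'n)) set" where
  "Mstar11 = {structure_vector (\<lambda>x y. \<theta> y *v* x + \<theta> x *v* y) | \<theta>. \<theta> \<in> dual}"

end

end

(* The coefficients of a, a^2, a^3 in the action of a transvection 1 + a E map every submodule
   to itself, because a field with more than two elements separates these three powers. With them, a
   vector of C outside K produces a square coordinate vector and hence all of N, a vector of K outside
   M produces a vector v_i v_j -> v_k with distinct indices and hence all of U, and a vector outside T
   produces all trace functionals. So the submodules of C are exactly 0, M, U, K, N and C; M is
   contained in U if n is odd and a complement of U in K if n is even. *)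

theory Submission
  imports Defs
begin

section \<open>Structure vectors and products\<close>

text \<open>On commutative products in characteristic 2 the map x -> [x,x] is additive, and
  \<open>K\<close> is its kernel in \<open>C\<close>; so \<open>K\<close> sits inside
  \<open>C\<close> instead of complementing it, and no averaging splits a vector into its parts.

  The coefficient of a is the Lie algebra action, but its square is twice the coefficient of a^2,
  hence 0. The Lie algebra therefore does not yield the coefficient of a^2, a divided power, and it
  has to be extracted separately. As the action has degree 3 in a, three distinct nonzero scalars
  are wanted, and a field of characteristic 2 with more than two elements has them.

  Parity enters in one place: for [u,v] = \<theta>(v)u + \<theta>(u)v the trace of v -> [u,v] is
  (n+1)\<theta>(u), so \<open>Mstar11\<close> lies in \<open>T\<close> or meets it only in 0.

  Once the submodules are listed, a quotient is irreducible exactly if it belongs to a covering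
  pair, and composition series are the maximal chains of a poset with six elements, which leaves a
  finite check.\<close>

context based_space
begin

lemma in_span_basis [simp]: "x \<in> span (range v)"
  by (simp add: span_basis)

lemma coord_add: "coord (x + y) i = coord x i + coord y i"
  by (simp add: coord_def representation_add independent_basis)

lemma coord_scale: "coord (c *v* x) i = c * coord x i"
  by (simp add: coord_def representation_scale independent_basis)

lemma coord_diff: "coord (x - y) i = coord x i - coord y i"
  using coord_add[of "x - y" y i] by simp

lemma coord_0 [simp]: "coord 0 i = 0"
  by (simp add: coord_def representation_zero)

lemma coord_sum: "coord (sum f A) i = (\<Sum>a\<in>A. coord (f a) i)"
  by (simp add: coord_def representation_sum independent_basis)

lemma coord_basis: "coord (v j) i = (if i = j then 1 else 0)"
  by (auto simp: coord_def representation_basis independent_basis inj_eq[OF inj_basis])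

lemma coord_expansion: "(\<Sum>i\<in>UNIV. coord x i *v* v i) = x"
proof -
  have "(\<Sum>b\<in>range v. representation (range v) x b *v* b) = x"
    by (rule sum_representation_eq) (auto simp: independent_basis)
  then show ?thesis
    by (simp add: sum.reindex[OF inj_basis] coord_def)
qed

lemma coord_eqI: "(\<And>i. coord x i = coord y i) \<Longrightarrow> x = y"
  by (subst coord_expansion[symmetric], subst (2) coord_expansion[symmetric]) simp

lemma coord_product:
  "coord (product l x y) k = (\<Sum>i\<in>UNIV. \<Sum>j\<in>UNIV. coord x i * coord y j * l $ (i, j, k))"
  by (simp add: product_def coord_sum coord_scale coord_basis mult_delta_right)

lemma coord_product_basis: "coord (product l (v i) (v j)) k = l $ (i, j, k)"
proof -
  have "coord (product l (v i) (v j)) k =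
      (\<Sum>a\<in>UNIV. coord (v i) a * (\<Sum>b\<in>UNIV. coord (v j) b * l $ (a, b, k)))"
    by (simp add: coord_product sum_distrib_left mult.assoc)
  then show ?thesis by (simp add: coord_basis mult_delta_left)
qed

section \<open>Bilinear maps on \<open>V\<close> and their structure vectors\<close>

definition bilin :: "('v \<Rightarrow> 'v \<Rightarrow> 'v) \<Rightarrow> bool" where
  "bilin p \<longleftrightarrow> (\<forall>x y z. p (x + y) z = p x z + p y z \<and> p z (x + y) = p z x + p z y) \<and>
     (\<forall>c x y. p (c *v* x) y = c *v* p x y \<and> p x (c *v* y) = c *v* p x y)"

lemma bilin_product: "bilin (product l)"
  unfolding bilin_def
proof (intro conjI allI)
  fix x y z c
  show "product l (x + y) z = product l x z + product l y z"
    by (rule coord_eqI) (simp add: coord_product coord_add distrib_right sum.distrib)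
  show "product l z (x + y) = product l z x + product l z y"
    by (rule coord_eqI)
      (simp add: coord_product coord_add distrib_left distrib_right sum.distrib)
  show "product l (c *v* x) y = c *v* product l x y"
    by (rule coord_eqI) (simp add: coord_product coord_scale sum_distrib_left mult.assoc)
  show "product l x (c *v* y) = c *v* product l x y"
    by (rule coord_eqI)
      (simp add: coord_product coord_scale sum_distrib_left mult.assoc mult.left_commute)
qed

lemma product_add_left: "product l (x + y) z = product l x z + product l y z"
  and product_add_right: "product l z (x + y) = product l z x + product l z y"
  and product_scale_left: "product l (c *v* x) y = c *v* product l x y"
  and product_scale_right: "product l x (c *v* y) = c *v* product l x y"
  using bilin_product[of l] by (auto simp: bilin_def)

lemma structure_vector_nth: "structure_vector p $ (i, j, k) = coord (p (v i) (v j)) k"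
  by (simp add: structure_vector_def)

lemma bilin_sum_left:
  assumes "bilin p" shows "p (sum f A) y = (\<Sum>a\<in>A. p (f a) y)"
proof -
  have "p 0 y = 0" using assms unfolding bilin_def by (metis add_cancel_left_left)
  then show ?thesis
    using assms by (induction A rule: infinite_finite_induct) (auto simp: bilin_def)
qed

lemma bilin_sum_right:
  assumes "bilin p" shows "p y (sum f A) = (\<Sum>a\<in>A. p y (f a))"
proof -
  have "p y 0 = 0" using assms unfolding bilin_def by (metis add_cancel_left_left)
  then show ?thesis
    using assms by (induction A rule: infinite_finite_induct) (auto simp: bilin_def)
qed

text \<open>Both arguments are expanded in the basis. Vectors defined through a map, as in the
  action and in \<open>Mstar11\<close>, can then be handled through that map instead of
  coordinates.\<close>

lemma product_structure_vector:
  assumes "bilin p" shows "product (structure_vector p) = p"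
proof (intro ext)
  fix x y
  have "p x y = p (\<Sum>i\<in>UNIV. coord x i *v* v i) (\<Sum>j\<in>UNIV. coord y j *v* v j)"
    by (simp only: coord_expansion)
  also have "\<dots> = (\<Sum>j\<in>UNIV. \<Sum>i\<in>UNIV. (coord x i * coord y j) *v* p (v i) (v j))"
    using assms
    by (simp add: bilin_sum_left[OF assms] bilin_sum_right[OF assms] bilin_def scale_sum_right)
      (simp add: mult.commute)
  also have "\<dots> = product (structure_vector p) x y"
    by (subst sum.swap) (simp add: product_def structure_vector_nth coord_expansion)
  finally show "product (structure_vector p) x y = p x y" by simp
qed

lemma product_inject: "product l = product l' \<Longrightarrow> l = l'"
  by (simp add: vec_eq_iff flip: coord_product_basis)

section \<open>The right action of \<open>GL\<close>\<close>

definition act :: "'f ^ ('n \<times> 'n \<times> 'n) \<Rightarrow> ('v \<Rightarrow> 'v) \<Rightarrow> 'f ^ ('n \<times> 'n \<times> 'n)" where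
  "act l g = structure_vector (\<lambda>x y. inv g (product l (g x) (g y)))"

lemma GL_add: "g \<in> GL \<Longrightarrow> g (x + y) = g x + g y"
  and GL_scale: "g \<in> GL \<Longrightarrow> g (c *v* x) = c *v* g x"
  and GL_bij: "g \<in> GL \<Longrightarrow> bij g"
  by (auto simp: GL_def Vector_Spaces.linear_def module_hom_def module_hom_axioms_def)

lemma GL_I:
  assumes "\<And>x y. g (x + y) = g x + g y" "\<And>c x. g (c *v* x) = c *v* g x" "bij g"
  shows "g \<in> GL"
  using assms vector_space_axioms module_axioms
  by (auto simp: GL_def Vector_Spaces.linear_def module_hom_def module_hom_axioms_def)

lemma GL_inv: assumes "g \<in> GL" shows "inv g \<in> GL"
proof (rule GL_I)
  note b = GL_bij[OF assms]
  have inv_eq: "inv g y = x" if "g x = y" for x y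
    using b that by (metis bij_inv_eq_iff)
  have r: "g (inv g y) = y" for y using b by (simp add: bij_is_surj surj_f_inv_f)
  show "inv g (x + y) = inv g x + inv g y" for x y
    by (rule inv_eq) (simp add: GL_add[OF assms] r)
  show "inv g (c *v* x) = c *v* inv g x" for c x
    by (rule inv_eq) (simp add: GL_scale[OF assms] r)
  show "bij (inv g)" by (rule bij_imp_bij_inv[OF b])
qed

lemma product_act:
  assumes "g \<in> GL"
  shows "product (act l g) x y = inv g (product l (g x) (g y))"
proof -
  have "bilin (\<lambda>x y. inv g (product l (g x) (g y)))"
    using assms GL_inv[OF assms]
    by (auto simp: bilin_def GL_add GL_scale product_add_left product_add_right
        product_scale_left product_scale_right)
  then show ?thesis unfolding act_def by (simp add: product_structure_vector)
qed

text \<open>Acting by \<open>g\<close> is thus onto every submodule, which makes the image of a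
  coset a whole coset in \<open>coset_act\<close>.\<close>

lemma act_act_inv: assumes "g \<in> GL" shows "act (act l (inv g)) g = l"
proof (rule product_inject, intro ext)
  fix x y
  have "inv (inv g) = g" using GL_bij[OF assms] by (simp add: inv_inv_eq)
  then show "product (act (act l (inv g)) g) x y = product l x y"
    using GL_bij[OF assms]
    by (simp add: product_act assms GL_inv bij_is_inj inv_f_f)
qed

lemma product_add: "product (l + l') x y = product l x y + product l' x y"
  by (rule coord_eqI) (simp add: coord_product coord_add distrib_left sum.distrib)

lemma product_smult: "product (c *s l) x y = c *v* product l x y"
  by (rule coord_eqI) (simp add: coord_product coord_scale sum_distrib_left mult.left_commute)

lemma product_0 [simp]: "product 0 x y = 0"
  by (rule coord_eqI) (simp add: coord_product)

lemma act_add: assumes "g \<in> GL" shows "act (l + l') g = act l g + act l' g"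
  by (rule product_inject, intro ext)
    (simp add: product_add product_act assms GL_inv GL_add)

section \<open>Submodules of the space of structure vectors\<close>

lemma Lambda_simps [simp]:
  "gm_carrier Lambda = UNIV" "gm_zero Lambda = 0" "gm_add Lambda = (+)" "gm_scale Lambda = (*s)"
  "gm_group Lambda = GL" "gm_act Lambda = act"
  by (simp_all add: Lambda_def act_def[abs_def])

abbreviation submod :: "('f ^ ('n \<times> 'n \<times> 'n)) set \<Rightarrow> bool" where
  "submod \<equiv> gm_submodule Lambda"

lemma submod_def:
  "submod W \<longleftrightarrow> 0 \<in> W \<and> (\<forall>x\<in>W. \<forall>y\<in>W. x + y \<in> W) \<and> (\<forall>c. \<forall>x\<in>W. c *s x \<in> W) \<and>
     (\<forall>g\<in>GL. \<forall>x\<in>W. act x g \<in> W)"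
  by (simp add: gm_submodule_def)

lemma gm_restrict_simps [simp]:
  "gm_carrier (gm_restrict R W) = W" "gm_zero (gm_restrict R W) = gm_zero R"
  "gm_add (gm_restrict R W) = gm_add R" "gm_scale (gm_restrict R W) = gm_scale R"
  "gm_group (gm_restrict R W) = gm_group R" "gm_act (gm_restrict R W) = gm_act R"
  by (simp_all add: gm_restrict_def)

lemma submodule_restrict:
  "gm_submodule (gm_restrict Lambda B) W \<longleftrightarrow> submod W \<and> W \<subseteq> B"
  by (auto simp: gm_submodule_def)

lemma restrict_restrict: "gm_restrict (gm_restrict R A) B = gm_restrict R B"
  by (simp add: gm_restrict_def)

lemma submod_0: "submod W \<Longrightarrow> 0 \<in> W"
  and submod_add: "submod W \<Longrightarrow> x \<in> W \<Longrightarrow> y \<in> W \<Longrightarrow> x + y \<in> W"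
  and submod_smult: "submod W \<Longrightarrow> x \<in> W \<Longrightarrow> c *s x \<in> W"
  and submod_act: "submod W \<Longrightarrow> x \<in> W \<Longrightarrow> g \<in> GL \<Longrightarrow> act x g \<in> W"
  by (auto simp: submod_def)

lemma submod_uminus: assumes "submod W" "x \<in> W" shows "- x \<in> W"
  using submod_smult[OF assms, of "-1"] by (simp only: vector_sneg_minus1)

lemma submod_diff: "submod W \<Longrightarrow> x \<in> W \<Longrightarrow> y \<in> W \<Longrightarrow> x - y \<in> W"
  unfolding diff_conv_add_uminus by (intro submod_add submod_uminus)

lemma submod_sum: "submod W \<Longrightarrow> (\<And>a. a \<in> A \<Longrightarrow> f a \<in> W) \<Longrightarrow> sum f A \<in> W"
  by (induction A rule: infinite_finite_induct) (auto simp: submod_0 submod_add)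

subsection \<open>Quotients\<close>

definition coset :: "('f ^ ('n \<times> 'n \<times> 'n)) set \<Rightarrow> 'f ^ ('n \<times> 'n \<times> 'n) \<Rightarrow> ('f ^ ('n \<times> 'n \<times> 'n)) set"
  where "coset A x = {x + w | w. w \<in> A}"

lemma mem_coset: "y \<in> coset A x \<longleftrightarrow> y - x \<in> A"
  by (auto simp: coset_def intro!: exI[of _ "y - x"])

lemma coset_eq: assumes "submod A" "y \<in> coset A x" shows "coset A x = coset A y"
proof -
  have "z - x \<in> A \<longleftrightarrow> z - y \<in> A" for z
    using assms submod_add[OF assms(1), of "z - y" "y - x"] submod_diff[OF assms(1), of "z - x" "y - x"]
    by (auto simp: mem_coset)
  then show ?thesis by (auto simp: mem_coset)
qed

lemma coset_0: "coset A 0 = A" by (simp add: coset_def)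

lemma coset_mem: "submod A \<Longrightarrow> x \<in> A \<Longrightarrow> coset A x = A"
  using coset_eq[of A x 0] by (simp add: coset_0)

lemma coset_image_self: "submod A \<Longrightarrow> coset A ` A = {A}"
  using submod_0[of A] coset_mem[of A] by (simp add: image_constant_conv set_eq_iff image_iff) blast

lemma quotient_simps:
  "gm_carrier (gm_quotient (gm_restrict Lambda B) A) = coset A ` B"
  "gm_zero (gm_quotient (gm_restrict Lambda B) A) = A"
  "gm_add (gm_quotient (gm_restrict Lambda B) A) P Q = {a + b | a b. a \<in> P \<and> b \<in> Q}"
  "gm_scale (gm_quotient (gm_restrict Lambda B) A) c P = {c *s a + w | a w. a \<in> P \<and> w \<in> A}"
  "gm_group (gm_quotient (gm_restrict Lambda B) A) = GL"
  "gm_act (gm_quotient (gm_restrict Lambda B) A) P g = {act a g | a. a \<in> P}"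
  by (auto simp: gm_quotient_def coset_def)

lemma coset_add: assumes "submod A"
  shows "{a + b | a b. a \<in> coset A x \<and> b \<in> coset A y} = coset A (x + y)"
proof (intro set_eqI iffI)
  fix z assume "z \<in> {a + b | a b. a \<in> coset A x \<and> b \<in> coset A y}"
  then obtain a b where z: "z = a + b" "a - x \<in> A" "b - y \<in> A" by (auto simp: mem_coset)
  then have "(a - x) + (b - y) \<in> A" using assms submod_add by blast
  then show "z \<in> coset A (x + y)" by (simp add: mem_coset z algebra_simps)
next
  fix z assume "z \<in> coset A (x + y)"
  then have "z = (z - y) + y" "z - y \<in> coset A x" "y \<in> coset A y"
    using submod_0[OF assms] by (auto simp: mem_coset algebra_simps)
  then show "z \<in> {a + b | a b. a \<in> coset A x \<and> b \<in> coset A y}" by blast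
qed

lemma coset_smult: assumes "submod A"
  shows "{c *s a + w | a w. a \<in> coset A x \<and> w \<in> A} = coset A (c *s x)"
proof (intro set_eqI iffI)
  fix z assume "z \<in> {c *s a + w | a w. a \<in> coset A x \<and> w \<in> A}"
  then obtain a w where z: "z = c *s a + w" "a - x \<in> A" "w \<in> A" by (auto simp: mem_coset)
  then have "c *s (a - x) + w \<in> A" using assms submod_add submod_smult by blast
  then show "z \<in> coset A (c *s x)" by (simp add: mem_coset z algebra_simps)
next
  fix z assume "z \<in> coset A (c *s x)"
  then have "z = c *s x + (z - c *s x)" "z - c *s x \<in> A" "x \<in> coset A x"
    using submod_0[OF assms] by (auto simp: mem_coset algebra_simps)
  then show "z \<in> {c *s a + w | a w. a \<in> coset A x \<and> w \<in> A}" by blast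
qed

lemma coset_act: assumes "submod A" "g \<in> GL"
  shows "{act a g | a. a \<in> coset A x} = coset A (act x g)"
proof (intro set_eqI iffI)
  fix z assume "z \<in> {act a g | a. a \<in> coset A x}"
  then obtain w where "z = act (x + w) g" "w \<in> A" by (auto simp: coset_def)
  then show "z \<in> coset A (act x g)"
    using submod_act[OF assms(1) _ assms(2)] by (auto simp: coset_def act_add assms(2))
next
  fix z assume "z \<in> coset A (act x g)"
  then obtain w where w: "z = act x g + w" "w \<in> A" by (auto simp: coset_def)
  then have "z = act (x + act w (inv g)) g" "act w (inv g) \<in> A"
    using submod_act[OF assms(1) _ GL_inv[OF assms(2)]] by (auto simp: act_add act_act_inv assms(2))
  then show "z \<in> {act a g | a. a \<in> coset A x}" by (auto simp: coset_def)
qed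

text \<open>The correspondence theorem: submodules of the quotient are the sets of cosets of the
  submodules between \<open>A\<close> and \<open>B\<close>. It removes quotients from everything
  that follows.\<close>

lemma irreducible_quotient_iff:
  assumes A: "submod A" and B: "submod B" and AB: "A \<subseteq> B"
  shows "gm_irreducible (gm_quotient (gm_restrict Lambda B) A) \<longleftrightarrow>
    A \<noteq> B \<and> (\<forall>X. submod X \<and> A \<subseteq> X \<and> X \<subseteq> B \<longrightarrow> X = A \<or> X = B)"
    (is "gm_irreducible ?Q \<longleftrightarrow> ?R")
proof
  have self: "x \<in> coset A x" for x using submod_0[OF A] by (simp add: mem_coset)
  \<comment> \<open>A submodule above \<open>A\<close> is recovered from its set of cosets, so
    distinct ones stay distinct in the quotient.\<close>
  have union: "\<Union> (coset A ` X) = X" if "submod X" "A \<subseteq> X" for X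
  proof
    show "X \<subseteq> \<Union> (coset A ` X)" using self by blast
    show "\<Union> (coset A ` X) \<subseteq> X"
      using submod_add[OF that(1)] that(2) by (auto simp: coset_def)
  qed
  assume irr: "gm_irreducible ?Q"
  have "X = A \<or> X = B" if X: "submod X" "A \<subseteq> X" "X \<subseteq> B" for X
  proof -
    have "gm_submodule ?Q (coset A ` X)"
      unfolding gm_submodule_def quotient_simps
    proof (intro conjI ballI allI)
      show "coset A ` X \<subseteq> coset A ` B" using X by blast
      show "A \<in> coset A ` X" using coset_0 submod_0[OF X(1)] by (metis imageI)
    qed (use submod_add[OF X(1)] submod_smult[OF X(1)] submod_act[OF X(1)] in
        \<open>auto simp: coset_add[OF A] coset_smult[OF A] coset_act[OF A]\<close>)
    then have "coset A ` X = {A} \<or> coset A ` X = coset A ` B"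
      using irr by (simp add: gm_irreducible_def quotient_simps)
    then have "\<Union> (coset A ` X) = A \<or> \<Union> (coset A ` X) = \<Union> (coset A ` B)"
      by (metis cSup_singleton)
    then show ?thesis by (simp only: union[OF X(1,2)] union[OF B AB])
  qed
  moreover have "A \<noteq> B"
  proof
    assume "A = B"
    then have "coset A ` B = {A}"
      using coset_image_self[OF A] by simp
    then show False using irr by (simp add: gm_irreducible_def quotient_simps)
  qed
  ultimately show ?R by blast
next
  have self: "x \<in> coset A x" for x using submod_0[OF A] by (simp add: mem_coset)
  assume R: ?R
  have "Y = {A} \<or> Y = coset A ` B" if Y: "gm_submodule ?Q Y" for Y
  proof -
    have Yc: "Y \<subseteq> coset A ` B" and Y0: "A \<in> Y"
      and Yadd: "\<And>P Q. P \<in> Y \<Longrightarrow> Q \<in> Y \<Longrightarrow> {a + b | a b. a \<in> P \<and> b \<in> Q} \<in> Y"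
      and Ys: "\<And>c P. P \<in> Y \<Longrightarrow> {c *s a + w | a w. a \<in> P \<and> w \<in> A} \<in> Y"
      and Ya: "\<And>g P. g \<in> GL \<Longrightarrow> P \<in> Y \<Longrightarrow> {act a g | a. a \<in> P} \<in> Y"
      using Y unfolding gm_submodule_def quotient_simps by auto
    \<comment> \<open>The preimage of \<open>Y\<close> under the projection.\<close>
    let ?X = "{x. coset A x \<in> Y}"
    have "submod ?X"
      unfolding submod_def
      using Y0 Yadd Ys Ya by (auto simp: coset_0 simp flip: coset_add[OF A] coset_smult[OF A] coset_act[OF A])
    moreover have "A \<subseteq> ?X" using Y0 by (auto simp: coset_mem[OF A])
    moreover have XB: "?X \<subseteq> B"
    proof
      fix x assume "x \<in> ?X"
      then obtain b where "b \<in> B" "coset A x = coset A b" using Yc by auto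
      then have "b \<in> B" "x - b \<in> A" using self[of x] by (auto simp: mem_coset)
      then show "x \<in> B" using submod_add[OF B, of "x - b" b] AB by auto
    qed
    ultimately have "?X = A \<or> ?X = B" using R by blast
    moreover have "Y = coset A ` ?X" using Yc by auto
    ultimately show ?thesis
      using coset_image_self[OF A] by auto
  qed
  moreover have "coset A ` B \<noteq> {A}"
  proof
    assume *: "coset A ` B = {A}"
    have "B \<subseteq> A"
    proof
      fix b assume "b \<in> B"
      then have "coset A b = A" using * by blast
      then show "b \<in> A" using self[of b] by simp
    qed
    then show False using R AB by blast
  qed
  ultimately show "gm_irreducible ?Q" by (simp add: gm_irreducible_def quotient_simps)
qed

subsection \<open>Coordinates of the submodules\<close>

lemma linear_trace_eq: "linear_trace f = (\<Sum>j\<in>UNIV. coord (f (v j)) j)"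
  by (simp add: linear_trace_def trace_def)

text \<open>The values on the basis of the functional \<open>linear_trace (product l x)\<close> of
  \<open>x\<close>; \<open>T\<close> is the kernel of \<open>tau\<close>.\<close>

definition tau :: "'f ^ ('n \<times> 'n \<times> 'n) \<Rightarrow> 'n \<Rightarrow> 'f" where
  "tau l i = (\<Sum>j\<in>UNIV. l $ (i, j, j))"

lemma linear_trace_product: "linear_trace (product l x) = (\<Sum>i\<in>UNIV. coord x i * tau l i)"
proof -
  have "linear_trace (product l x) = (\<Sum>j\<in>UNIV. \<Sum>i\<in>UNIV. coord x i * l $ (i, j, j))"
    by (simp add: linear_trace_eq coord_product coord_basis mult_delta_left mult_delta_right)
  also have "\<dots> = (\<Sum>i\<in>UNIV. coord x i * tau l i)"
    unfolding tau_def sum_distrib_left by (rule sum.swap)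
  finally show ?thesis .
qed

lemma mem_T_iff: "l \<in> T \<longleftrightarrow> (\<forall>i. tau l i = 0)"
proof
  assume "l \<in> T"
  then have "linear_trace (product l (v i)) = 0" for i by (simp add: T_def)
  then show "\<forall>i. tau l i = 0"
    by (simp add: linear_trace_product coord_basis mult_delta_left)
qed (simp add: T_def linear_trace_product)

lemma mem_C_iff: "l \<in> C \<longleftrightarrow> (\<forall>i j k. l $ (i, j, k) = l $ (j, i, k))"
proof
  assume "l \<in> C" then show "\<forall>i j k. l $ (i, j, k) = l $ (j, i, k)"
    by (simp add: C_def flip: coord_product_basis)
next
  assume *: "\<forall>i j k. l $ (i, j, k) = l $ (j, i, k)"
  have "coord (product l x y) k = coord (product l y x) k" for x y k
  proof -
    have "coord (product l x y) k = (\<Sum>i\<in>UNIV. \<Sum>j\<in>UNIV. coord x i * coord y j * l $ (j, i, k))"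
      unfolding coord_product
      by (intro sum.cong arg_cong2[where f = "(*)"] refl) (rule *[rule_format])
    also have "\<dots> = coord (product l y x) k"
      unfolding coord_product by (subst sum.swap) (simp add: mult.commute)
    finally show ?thesis .
  qed
  then show "l \<in> C" by (auto simp: C_def intro: coord_eqI)
qed

text \<open>Both traces are the same double sum over matrix entries with the order of summation
  exchanged. It supplies the invariance under conjugation for \<open>submod_T\<close>.\<close>

lemma linear_trace_commute:
  assumes f: "\<And>x y. f (x + y) = f x + f y" "\<And>c x. f (c *v* x) = c *v* f x"
    and g: "\<And>x y. g (x + y) = g x + g y" "\<And>c x. g (c *v* x) = c *v* g x"
  shows "linear_trace (f \<circ> g) = linear_trace (g \<circ> f)"
proof -
  have *: "coord (f x) j = (\<Sum>i\<in>UNIV. coord x i * coord (f (v i)) j)"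
    if f: "\<And>x y. f (x + y) = f x + f y" "\<And>c x. f (c *v* x) = c *v* f x" for f x j
  proof -
    have f0: "f 0 = 0" using f(1)[of 0 0] by simp
    have fs: "f (sum h A) = (\<Sum>a\<in>A. f (h a))" for h and A :: "'n set"
      by (induction A rule: infinite_finite_induct) (auto simp: f0 f)
    have "f x = f (\<Sum>i\<in>UNIV. coord x i *v* v i)" by (simp only: coord_expansion)
    then show ?thesis by (simp add: fs f coord_sum coord_scale)
  qed
  have "linear_trace (f \<circ> g) = (\<Sum>j\<in>UNIV. \<Sum>i\<in>UNIV. coord (g (v j)) i * coord (f (v i)) j)"
    unfolding linear_trace_eq comp_def by (subst *[OF f]) simp
  also have "\<dots> = (\<Sum>i\<in>UNIV. \<Sum>j\<in>UNIV. coord (f (v i)) j * coord (g (v j)) i)"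
    by (subst sum.swap) (simp add: mult.commute)
  also have "\<dots> = linear_trace (g \<circ> f)"
    unfolding linear_trace_eq comp_def by (subst *[OF g, of "f _"]) simp
  finally show ?thesis .
qed

lemma submod_C: "submod C"
  unfolding submod_def by (auto simp: C_def product_add product_smult product_act)

lemma GL_0: "g \<in> GL \<Longrightarrow> g 0 = 0"
  using GL_add[of g 0 0] by simp

lemma submod_K: "submod K"
  unfolding submod_def by (auto simp: K_def product_add product_smult product_act GL_0 GL_inv)

lemma tau_add: "tau (l + l') i = tau l i + tau l' i"
  by (simp add: tau_def sum.distrib)

lemma tau_smult: "tau (c *s l) i = c * tau l i"
  by (simp add: tau_def sum_distrib_left)

lemma tau_0: "tau 0 i = 0" by (simp add: tau_def)

lemma submod_T: "submod T"
  unfolding submod_def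
proof (intro conjI ballI allI)
  fix g l assume g: "g \<in> GL" and l: "l \<in> T"
  note i = GL_inv[OF g]
  have "linear_trace (product (act l g) x) = 0" for x
  proof -
    \<comment> \<open>Left multiplication by \<open>x\<close> in the transformed product is
      conjugate under \<open>g\<close> to left multiplication by \<open>g x\<close> in the old
      one.\<close>
    have "product (act l g) x = inv g \<circ> (product l (g x) \<circ> g)"
      by (auto simp: fun_eq_iff product_act[OF g])
    then have "linear_trace (product (act l g) x) = linear_trace ((product l (g x) \<circ> g) \<circ> inv g)"
      by (simp only:) (rule linear_trace_commute;
        simp add: GL_add[OF g] GL_scale[OF g] GL_add[OF i] GL_scale[OF i] product_add_right product_scale_right)
    also have "(product l (g x) \<circ> g) \<circ> inv g = product l (g x)"
      using GL_bij[OF g] by (auto simp: fun_eq_iff bij_is_surj surj_f_inv_f)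
    finally show ?thesis using l by (simp add: T_def)
  qed
  then show "act l g \<in> T" by (simp add: T_def)
qed (auto simp: mem_T_iff tau_add tau_smult tau_0)

lemma submod_Int: "submod A \<Longrightarrow> submod B \<Longrightarrow> submod (A \<inter> B)"
  by (simp add: submod_def)

text \<open>The general element of \<open>Mstar11\<close> in coordinates, with \<open>t i\<close>
  for the value of \<theta> at \<open>v i\<close>.\<close>

definition m11 :: "('n \<Rightarrow> 'f) \<Rightarrow> 'f ^ ('n \<times> 'n \<times> 'n)" where
  "m11 t = (\<chi> x. case x of (i, j, k) \<Rightarrow> (if i = k then t j else 0) + (if j = k then t i else 0))"

lemma m11_nth: "m11 t $ (i, j, k) = (if i = k then t j else 0) + (if j = k then t i else 0)"
  by (simp add: m11_def)

lemma dual_iff: "\<theta> \<in> dual \<longleftrightarrow> (\<forall>x y. \<theta> (x + y) = \<theta> x + \<theta> y) \<and> (\<forall>c x. \<theta> (c *v* x) = c * \<theta> x)"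
  using vector_space_axioms module_axioms vector_space_over_itself.vector_space_axioms
    vector_space_over_itself.module_axioms
  by (auto simp: dual_def Vector_Spaces.linear_def module_hom_def module_hom_axioms_def)

lemma Mstar11_eq: "Mstar11 = range m11"
proof -
  have *: "structure_vector (\<lambda>x y. \<theta> y *v* x + \<theta> x *v* y) = m11 (\<lambda>i. \<theta> (v i))" for \<theta>
    by (auto simp: vec_eq_iff structure_vector_nth m11_nth coord_add coord_scale coord_basis)
  have "\<exists>\<theta>\<in>dual. m11 t = structure_vector (\<lambda>x y. \<theta> y *v* x + \<theta> x *v* y)" for t
  proof (rule bexI)
    let ?\<theta> = "\<lambda>x. \<Sum>i\<in>UNIV. coord x i * t i"
    show "?\<theta> \<in> dual"
      by (auto simp: dual_iff coord_add coord_scale algebra_simps sum.distrib sum_distrib_left)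
    show "m11 t = structure_vector (\<lambda>x y. ?\<theta> y *v* x + ?\<theta> x *v* y)"
      by (simp add: * coord_basis mult_delta_left)
  qed
  then show ?thesis unfolding Mstar11_def using * by auto
qed

lemma submod_M: "submod Mstar11"
  unfolding submod_def
proof (intro conjI ballI allI)
  show "0 \<in> Mstar11"
    unfolding Mstar11_eq by (rule range_eqI[of _ _ "\<lambda>_. 0"]) (auto simp: vec_eq_iff m11_nth)
next
  fix x y assume "x \<in> Mstar11" "y \<in> Mstar11"
  then obtain s t where "x = m11 s" "y = m11 t" by (auto simp: Mstar11_eq)
  then have "x + y = m11 (\<lambda>i. s i + t i)" by (auto simp: vec_eq_iff m11_nth)
  then show "x + y \<in> Mstar11" by (simp add: Mstar11_eq)
next
  fix c x assume "x \<in> Mstar11"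
  then obtain s where "x = m11 s" by (auto simp: Mstar11_eq)
  then have "c *s x = m11 (\<lambda>i. c * s i)" by (auto simp: vec_eq_iff m11_nth algebra_simps)
  then show "c *s x \<in> Mstar11" by (simp add: Mstar11_eq)
next
  fix g l assume g: "g \<in> GL" and "l \<in> Mstar11"
  then obtain \<theta> where th: "\<theta> \<in> dual" and l: "l = structure_vector (\<lambda>x y. \<theta> y *v* x + \<theta> x *v* y)"
    by (auto simp: Mstar11_def)
  note i = GL_inv[OF g]
  have "bilin (\<lambda>x y. \<theta> y *v* x + \<theta> x *v* y)"
    using th by (auto simp: bilin_def dual_iff algebra_simps)
  \<comment> \<open>The two factors \<open>g\<close> and \<open>inv g\<close> cancel on vectors, so
    only the functional changes, to \<theta> composed with \<open>g\<close>.\<close>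
  then have "act l g = structure_vector (\<lambda>x y. \<theta> (g y) *v* x + \<theta> (g x) *v* y)"
    using GL_bij[OF g] unfolding act_def l
    by (simp add: product_structure_vector GL_add[OF i] GL_scale[OF i] bij_is_inj inv_f_f)
  moreover have "\<theta> \<circ> g \<in> dual"
    using th by (auto simp: dual_iff GL_add[OF g] GL_scale[OF g])
  ultimately show "act l g \<in> Mstar11"
    unfolding Mstar11_def by (auto intro!: exI[of _ "\<theta> \<circ> g"])
qed

subsection \<open>Transvections\<close>

text \<open>Let E send \<open>v q\<close> to \<open>v p\<close> and the other basis vectors to 0.
  Since \<open>p\<close> and \<open>q\<close> differ, E^2 = 0 and 1 - aE inverts \<open>g\<close>.
  The local \<open>b\<close> holds the coordinates of [g v_i, g v_j]; applying the inverse only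
  changes coordinate \<open>p\<close>.\<close>

lemma act_transvection_nth:
  fixes p q :: 'n and a :: 'f
  assumes "p \<noteq> q"
  defines "g \<equiv> \<lambda>x. x + (a * coord x q) *v* v p"
  shows "g \<in> GL"
    and "act l g $ (i, j, k) =
      (let b = (\<lambda>i j k. l $ (i, j, k) + (if i = q then a * l $ (p, j, k) else 0)
                 + (if j = q then a * l $ (i, p, k) else 0)
                 + (if i = q \<and> j = q then a\<^sup>2 * l $ (p, p, k) else 0))
       in b i j k - (if k = p then a * b i j q else 0))"
proof -
  let ?h = "\<lambda>x. x - (a * coord x q) *v* v p"
  have gq: "coord (g x) q = coord x q" and hq: "coord (?h x) q = coord x q" for x
    using assms(1) by (simp_all add: g_def coord_add coord_diff coord_scale coord_basis)
  have gh: "g (?h x) = x" for x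
    unfolding g_def hq by simp
  have hg: "?h (g x) = x" for x
    unfolding gq by (simp add: g_def)
  have b: "bij g" by (rule bijI'[of g]) (metis hg, metis gh)
  have inv: "inv g x = ?h x" for x using gh b by (metis bij_inv_eq_iff)
  show g: "g \<in> GL"
    by (rule GL_I[OF _ _ b])
      (simp_all add: g_def coord_add coord_scale distrib_left scale_left_distrib
        scale_right_distrib mult.left_commute)
  define y where "y = product l (g (v i)) (g (v j))"
  define c where "c = (\<lambda>i j k. l $ (i, j, k) + (if i = q then a * l $ (p, j, k) else 0)
                 + (if j = q then a * l $ (i, p, k) else 0)
                 + (if i = q \<and> j = q then a\<^sup>2 * l $ (p, p, k) else 0))"
  have gv: "g (v i) = (if i = q then v i + a *v* v p else v i)" for i
    by (simp add: g_def coord_basis)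
  have y: "coord y k = c i j k" for k
    unfolding y_def gv c_def
    by (simp add: product_add_left product_add_right product_scale_left
        product_scale_right coord_add coord_scale coord_product_basis power2_eq_square mult.assoc
        distrib_left)
  have "act l g $ (i, j, k) = coord (?h y) k"
    by (simp add: act_def structure_vector_nth y_def inv)
  also have "\<dots> = coord y k - (if k = p then a * coord y q else 0)"
    by (simp add: coord_diff coord_scale coord_basis)
  finally show "act l g $ (i, j, k) =
      (let b = (\<lambda>i j k. l $ (i, j, k) + (if i = q then a * l $ (p, j, k) else 0)
                 + (if j = q then a * l $ (i, p, k) else 0)
                 + (if i = q \<and> j = q then a\<^sup>2 * l $ (p, p, k) else 0))
       in b i j k - (if k = p then a * b i j q else 0))"
    by (simp add: y c_def Let_def)
qed

end


section \<open>Characteristic two\<close>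

locale char_2_space = based_space scale v
  for scale :: "'f::field \<Rightarrow> 'v::ab_group_add \<Rightarrow> 'v" (infixr \<open>*v*\<close> 75)
    and v :: "'n::finite \<Rightarrow> 'v" +
  assumes two_eq_0 [simp]: "(2 :: 'f) = 0"
    and ex_scalar: "\<exists>t :: 'f. t \<noteq> 0 \<and> t \<noteq> 1"
    and card_ge_3: "CARD('n) \<ge> 3"
begin

lemma add_self [simp]: "x + x = (0 :: 'f)"
  by (simp flip: mult_2)

lemma uminus_eq [simp]: "- x = (x :: 'f)"
  by (rule minus_unique) simp

lemma minus_eq: "x - y = (x + y :: 'f)"
  unfolding diff_conv_add_uminus by simp

lemma add_self_left [simp]: "x + (x + y) = (y :: 'f)"
  by (simp flip: add.assoc)

lemma ex_third: "\<exists>k :: 'n. k \<noteq> i \<and> k \<noteq> j"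
proof (rule ccontr)
  assume "\<not> ?thesis"
  then have "(UNIV :: 'n set) \<subseteq> {i, j}" by blast
  then have "CARD('n) \<le> card {i, j}" by (rule card_mono[rotated]) simp
  also have "\<dots> \<le> 2" by (simp add: card_insert_if)
  finally show False using card_ge_3 by simp
qed

text \<open>The terms for (i,j) and (j,i) cancel in characteristic 2.\<close>

lemma sum_symmetric_eq_0:
  fixes f :: "'n \<Rightarrow> 'n \<Rightarrow> 'f"
  assumes "\<And>i j. f i j = f j i" "\<And>i. f i i = 0"
  shows "(\<Sum>i\<in>A. \<Sum>j\<in>A. f i j) = 0"
proof (induction A rule: infinite_finite_induct)
  case (insert a A)
  have "(\<Sum>i\<in>A. f i a) = (\<Sum>i\<in>A. f a i)" by (intro sum.cong refl) (rule assms(1))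
  with insert show ?case by (simp add: sum.distrib assms(2))
qed auto

text \<open>One direction polarises [x,x] = 0 at \<open>v i + v j\<close>; in the other the mixed
  terms of [x,x] cancel in pairs and the squares vanish.\<close>

lemma mem_K_iff: "l \<in> K \<longleftrightarrow> l \<in> C \<and> (\<forall>i k. l $ (i, i, k) = 0)"
proof
  assume l: "l \<in> K"
  have "l $ (i, j, k) = l $ (j, i, k)" for i j k
  proof -
    have "product l (v i + v j) (v i + v j) = 0" "product l (v i) (v i) = 0"
        "product l (v j) (v j) = 0"
      using l by (simp_all add: K_def)
    then have "product l (v i) (v j) + product l (v j) (v i) = 0"
      by (simp add: product_add_left product_add_right add.commute)
    then have "coord (product l (v i) (v j) + product l (v j) (v i)) k = 0" by simp
    then show ?thesis
      by (simp add: coord_add coord_product_basis eq_neg_iff_add_eq_0[symmetric])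
  qed
  moreover have "l $ (i, i, k) = 0" for i k
    using l coord_product_basis[of l i i k] by (simp add: K_def)
  ultimately show "l \<in> C \<and> (\<forall>i k. l $ (i, i, k) = 0)" by (auto simp: mem_C_iff)
next
  assume l: "l \<in> C \<and> (\<forall>i k. l $ (i, i, k) = 0)"
  show "l \<in> K"
    unfolding K_def
  proof (safe intro!: coord_eqI)
    fix x k
    have "coord (product l x x) k = 0"
      unfolding coord_product
    proof (rule sum_symmetric_eq_0)
      fix i j
      have "l $ (i, j, k) = l $ (j, i, k)" using l unfolding mem_C_iff by blast
      then show "coord x i * coord x j * l $ (i, j, k) = coord x j * coord x i * l $ (j, i, k)"
        by simp
      show "coord x i * coord x i * l $ (i, i, k) = 0" using l by simp
    qed
    then show "coord (product l x x) k = coord 0 k" by simp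
  qed
qed

lemma submod_U: "submod U" and submod_N: "submod N"
  by (simp_all add: U_def N_def submod_Int submod_K submod_C submod_T)

lemma K_subset_C: "K \<subseteq> C" by (auto simp: mem_K_iff)

subsection \<open>Closure under the coefficients of transvections\<close>

text \<open>For the transvection \<open>g = 1 + a E\<close> with \<open>E v\<^sub>q = v\<^sub>p\<close>, the vector \<open>l g\<close> is
  \<open>l + a D1 l + a\<^sup>2 D2 l + a\<^sup>3 D3 l\<close>; \<open>D1\<close> is the action of \<open>E\<close> as a Lie algebra element.\<close>

definition D1 :: "'n \<Rightarrow> 'n \<Rightarrow> 'f ^ ('n \<times> 'n \<times> 'n) \<Rightarrow> 'f ^ ('n \<times> 'n \<times> 'n)" where
  "D1 p q l = (\<chi> x. case x of (i, j, k) \<Rightarrow>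
     (if i = q then l $ (p, j, k) else 0) + (if j = q then l $ (i, p, k) else 0)
     + (if k = p then l $ (i, j, q) else 0))"

definition D2 :: "'n \<Rightarrow> 'n \<Rightarrow> 'f ^ ('n \<times> 'n \<times> 'n) \<Rightarrow> 'f ^ ('n \<times> 'n \<times> 'n)" where
  "D2 p q l = (\<chi> x. case x of (i, j, k) \<Rightarrow>
     (if i = q \<and> j = q then l $ (p, p, k) else 0)
     + (if k = p \<and> i = q then l $ (p, j, q) else 0) + (if k = p \<and> j = q then l $ (i, p, q) else 0))"

definition D3 :: "'n \<Rightarrow> 'n \<Rightarrow> 'f ^ ('n \<times> 'n \<times> 'n) \<Rightarrow> 'f ^ ('n \<times> 'n \<times> 'n)" where
  "D3 p q l = (\<chi> x. case x of (i, j, k) \<Rightarrow> if i = q \<and> j = q \<and> k = p then l $ (p, p, q) else 0)"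

lemma D1_nth: "D1 p q l $ (i, j, k) =
     (if i = q then l $ (p, j, k) else 0) + (if j = q then l $ (i, p, k) else 0)
     + (if k = p then l $ (i, j, q) else 0)"
  and D2_nth: "D2 p q l $ (i, j, k) =
     (if i = q \<and> j = q then l $ (p, p, k) else 0)
     + (if k = p \<and> i = q then l $ (p, j, q) else 0) + (if k = p \<and> j = q then l $ (i, p, q) else 0)"
  and D3_nth: "D3 p q l $ (i, j, k) = (if i = q \<and> j = q \<and> k = p then l $ (p, p, q) else 0)"
  by (simp_all add: D1_def D2_def D3_def)

lemma vec3_eqI:
  fixes x y :: "'f ^ ('n \<times> 'n \<times> 'n)"
  assumes "\<And>i j k. x $ (i, j, k) = y $ (i, j, k)" shows "x = y"
  using assms by (simp add: vec_eq_iff)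

lemma act_transvection:
  assumes "p \<noteq> q"
  shows "act l (\<lambda>x. x + (a * coord x q) *v* v p)
    = l + a *s D1 p q l + a\<^sup>2 *s D2 p q l + a ^ 3 *s D3 p q l"
proof (rule vec3_eqI)
  fix i j k
  show "act l (\<lambda>x. x + (a * coord x q) *v* v p) $ (i, j, k)
    = (l + a *s D1 p q l + a\<^sup>2 *s D2 p q l + a ^ 3 *s D3 p q l) $ (i, j, k)"
    using assms
    by (simp add: act_transvection_nth D1_nth D2_nth D3_nth Let_def minus_eq
        distrib_left power2_eq_square power3_eq_cube mult.assoc add_ac)
qed

text \<open>Three nonzero scalars \<open>1, t, t + 1\<close> separate the powers \<open>a, a\<^sup>2, a\<^sup>3\<close>.\<close>

lemma D_closed:
  assumes W: "submod W" and l: "l \<in> W" and pq: "p \<noteq> q"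
  shows "D1 p q l \<in> W" and "D2 p q l \<in> W" and "D3 p q l \<in> W"
proof -
  define A where "A = (\<lambda>a. a *s D1 p q l + a\<^sup>2 *s D2 p q l + a ^ 3 *s D3 p q l)"
  have A: "A a \<in> W" for a
  proof -
    have "act l (\<lambda>x. x + (a * coord x q) *v* v p) - l \<in> W"
      by (rule submod_diff[OF W submod_act[OF W l] l]) (rule act_transvection_nth(1)[OF pq])
    then show ?thesis by (simp add: act_transvection[OF pq] A_def algebra_simps)
  qed
  \<comment> \<open>Subtracting \<open>t\<close> times the value at 1 removes the linear term; what
    remains has the common factor t^2 - t.\<close>
  have B: "D2 p q l + (t + 1) *s D3 p q l \<in> W" if t: "t \<noteq> 0" "t \<noteq> 1" for t
  proof -
    have nz: "t\<^sup>2 - t \<noteq> 0" using t by (simp add: power2_eq_square)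
    have "(1 / (t\<^sup>2 - t)) *s (A t - t *s A 1) = D2 p q l + (t + 1) *s D3 p q l"
    proof (rule vec3_eqI)
      fix i j k
      have "(t * x + t\<^sup>2 * y + t ^ 3 * z) - t * (x + y + z) = (t\<^sup>2 - t) * (y + (t + 1) * z)"
        for x y z :: 'f
        by (simp add: power2_eq_square power3_eq_cube algebra_simps del: uminus_eq)
      then have "1 / (t\<^sup>2 - t) * ((t * x + t\<^sup>2 * y + t ^ 3 * z) - t * (x + y + z)) = y + (t + 1) * z"
        for x y z :: 'f
        using nz by (simp only: mult.assoc[symmetric]) simp
      then show "((1 / (t\<^sup>2 - t)) *s (A t - t *s A 1)) $ (i, j, k)
          = (D2 p q l + (t + 1) *s D3 p q l) $ (i, j, k)"
        by (simp only: A_def vector_minus_component vector_add_component vector_smult_component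
            one_power2 power_one mult_1)
    qed
    then show ?thesis using submod_smult[OF W submod_diff[OF W A submod_smult[OF W A]]] by metis
  qed
  obtain t :: 'f where t: "t \<noteq> 0" "t \<noteq> 1" using ex_scalar by blast
  \<comment> \<open>\<open>B\<close> applies to \<open>t\<close> and to \<open>t + 1\<close>, and
    the two resulting coefficients of \<open>D3\<close> differ by exactly 1.\<close>
  have t': "t + 1 \<noteq> 0" "t + 1 \<noteq> 1" using t by (auto simp flip: minus_eq)
  have "D2 p q l + (t + 1 + 1) *s D3 p q l - (D2 p q l + (t + 1) *s D3 p q l) \<in> W"
    by (rule submod_diff[OF W B[OF t'] B[OF t]])
  also have "D2 p q l + (t + 1 + 1) *s D3 p q l - (D2 p q l + (t + 1) *s D3 p q l) = D3 p q l"
    by (rule vec3_eqI) (simp add: algebra_simps del: uminus_eq)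
  finally show D3: "D3 p q l \<in> W" .
  have "D2 p q l + (t + 1) *s D3 p q l - (t + 1) *s D3 p q l \<in> W"
    by (rule submod_diff[OF W B[OF t] submod_smult[OF W D3]])
  then show D2: "D2 p q l \<in> W" by simp
  have "A 1 - D2 p q l - D3 p q l \<in> W"
    by (intro submod_diff[OF W] A D2 D3)
  then show "D1 p q l \<in> W" by (simp add: A_def)
qed

section \<open>Coordinate vectors, their traces, and clearing of coordinates\<close>

definition e :: "'n \<Rightarrow> 'n \<Rightarrow> 'n \<Rightarrow> 'f ^ ('n \<times> 'n \<times> 'n)" where
  "e i j k = axis (i, j, k) 1"

text \<open>The commutative product with [v_i,v_j] = v_k as its only nonzero product of basis
  vectors, up to order. For \<open>i = j\<close> the two summands cancel and it is 0, so squares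
  need \<open>e\<close>.\<close>

definition s :: "'n \<Rightarrow> 'n \<Rightarrow> 'n \<Rightarrow> 'f ^ ('n \<times> 'n \<times> 'n)" where
  "s i j k = e i j k + e j i k"

lemma e_nth: "e i j k $ (a, b, c) = (if a = i \<and> b = j \<and> c = k then 1 else 0)"
  by (auto simp: e_def axis_def)

lemma s_nth: "s i j k $ (a, b, c) =
    (if a = i \<and> b = j \<and> c = k then 1 else 0) + (if a = j \<and> b = i \<and> c = k then 1 else 0)"
  by (simp add: s_def e_nth)

lemma s_commute: "s i j k = s j i k"
  by (simp add: s_def add.commute)

lemma tau_e: "tau (e i j k) a = (if a = i \<and> j = k then 1 else 0)"
proof -
  have "tau (e i j k) a = (\<Sum>b\<in>UNIV. if b = j then if a = i \<and> j = k then 1 else 0 else 0)"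
    unfolding tau_def e_nth by (intro sum.cong) auto
  then show ?thesis by simp
qed

lemma tau_s: "tau (s i j k) a = (if a = i \<and> j = k then 1 else 0) + (if a = j \<and> i = k then 1 else 0)"
  by (simp add: s_def tau_add tau_e)

text \<open>The change in the second lower index and the change in the upper index both contribute
  \<open>l $ (j, p, q)\<close> and cancel; what is left is the action of E on the dual
  space.\<close>

lemma tau_D1:
  assumes "p \<noteq> q" shows "tau (D1 p q l) j = (if j = q then tau l p else 0)"
  by (simp add: tau_def D1_nth sum.distrib)

text \<open>Only the coordinates in \<open>D\<close> are cleared one by one; the defining equations of \<open>X\<close>
  have to determine the remaining ones.\<close>

lemma subset_by_support:
  fixes D :: "('n \<times> 'n \<times> 'n) set"
  assumes W: "submod W" and X: "submod X"
    and step: "\<And>l. l \<in> X \<Longrightarrow> l \<noteq> 0 \<Longrightarrow>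
      \<exists>z\<in>W \<inter> X. \<exists>x\<in>D. l $ x \<noteq> 0 \<and> z $ x = 1 \<and> (\<forall>y\<in>D. z $ y \<noteq> 0 \<longrightarrow> l $ y \<noteq> 0)"
  shows "X \<subseteq> W"
proof
  fix l assume "l \<in> X"
  then show "l \<in> W"
  proof (induction "card {x \<in> D. l $ x \<noteq> 0}" arbitrary: l rule: less_induct)
    case less
    show ?case
    proof (cases "l = 0")
      case True then show ?thesis using submod_0[OF W] by simp
    next
      case False
      then obtain z x where z: "z \<in> W" "z \<in> X" "\<And>y. y \<in> D \<Longrightarrow> z $ y \<noteq> 0 \<Longrightarrow> l $ y \<noteq> 0"
        and x: "x \<in> D" "l $ x \<noteq> 0" "z $ x = 1"
        using step[OF less.prems] by blast
      define w where "w = l $ x *s z"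
      have w: "w \<in> W" "w \<in> X"
        using submod_smult[OF W z(1)] submod_smult[OF X z(2)] by (simp_all add: w_def)
      \<comment> \<open>Subtracting \<open>w\<close> clears coordinate \<open>x\<close> and, by the
        support condition on \<open>z\<close>, creates no nonzero coordinate in
        \<open>D\<close>.\<close>
      have "{x \<in> D. (l - w) $ x \<noteq> 0} \<subset> {x \<in> D. l $ x \<noteq> 0}"
      proof (rule psubsetI)
        show "{x \<in> D. (l - w) $ x \<noteq> 0} \<subseteq> {x \<in> D. l $ x \<noteq> 0}"
        proof (intro subsetI CollectI conjI)
          fix y assume y: "y \<in> {x \<in> D. (l - w) $ x \<noteq> 0}"
          then show "y \<in> D" by simp
          then show "l $ y \<noteq> 0" using y z(3)[of y] by (cases "z $ y = 0") (auto simp: w_def)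
        qed
        have "x \<notin> {x \<in> D. (l - w) $ x \<noteq> 0}" using x by (simp add: w_def)
        then show "{x \<in> D. (l - w) $ x \<noteq> 0} \<noteq> {x \<in> D. l $ x \<noteq> 0}" using x by blast
      qed
      then have "card {x \<in> D. (l - w) $ x \<noteq> 0} < card {x \<in> D. l $ x \<noteq> 0}"
        by (intro psubset_card_mono) auto
      then have "l - w \<in> W" by (rule less.hyps) (intro submod_diff[OF X less.prems w(2)])
      then show ?thesis using submod_add[OF W _ w(1), of "l - w"] by simp
    qed
  qed
qed

subsection \<open>The submodules generated by an element\<close>

text \<open>\<open>D1\<close> replaces the upper index and \<open>D2\<close> the repeated lower one;
  \<open>D1\<close> is useless for the latter, because it changes only one of the two lower indices
  at a time.\<close>

lemma d_all:
  assumes W: "submod W" and ab: "e a a b \<in> W" "a \<noteq> b" and ik: "i \<noteq> k"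
  shows "e k k i \<in> W"
proof -
  have upper: "e k k p \<in> W" if "e k k i \<in> W" "k \<noteq> i" "p \<noteq> k" for k i p
  proof (cases "p = i")
    case False
    have "D1 p i (e k k i) = e k k p"
      using that False by (intro vec3_eqI) (auto simp: D1_nth e_nth)
    then show ?thesis using D_closed(1)[OF W that(1) False] by simp
  qed (use that in simp)
  have lower: "e q q i \<in> W" if "e k k i \<in> W" "k \<noteq> i" "q \<noteq> i" for k i q
  proof (cases "k = q")
    case False
    have "D2 k q (e k k i) = e q q i"
      using that False by (intro vec3_eqI) (auto simp: D2_nth e_nth)
    then show ?thesis using D_closed(2)[OF W that(1) False] by simp
  qed (use that in simp)
  show ?thesis
  proof (cases "i = a")
    case False
    then show ?thesis using lower[OF upper[OF ab, of i]] ik by auto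
  next
    case True
    \<comment> \<open>The upper index cannot become \<open>a\<close> while the lower ones are
      \<open>a\<close>, so these first move out of the way to a third index.\<close>
    obtain m where "m \<noteq> a" "m \<noteq> b" using ex_third by blast
    then show ?thesis
      using lower[OF upper[OF lower[OF ab, of m], of a], of k] ik True by auto
  qed
qed

text \<open>\<open>N\<close> is spanned by the squares \<open>e k k i\<close>, the vectors
  \<open>s q k i\<close> with distinct indices, and \<open>s k i i + e k k k\<close>, whose last
  term corrects the trace. The coordinates (i,i,i) are left out of \<open>D\<close> since trace 0
  determines them from the others.\<close>

lemma N_subset_if_square:
  assumes W: "submod W" and ab: "e a a b \<in> W" "a \<noteq> b"
  shows "N \<subseteq> W"
proof (rule subset_by_support[where D = "{(i, j, k). \<not> (i = j \<and> i = k)}"])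
  have d: "e k k i \<in> W" if "i \<noteq> k" for k i using d_all[OF W ab that] .
  have s3: "s q k i \<in> W" if "q \<noteq> k" "q \<noteq> i" "k \<noteq> i" for q k i
  proof -
    have "D1 k q (e k k i) = s q k i"
      using that by (intro vec3_eqI) (auto simp: D1_nth e_nth s_nth)
    then show ?thesis using D_closed(1)[OF W d[of i k], of k q] that by simp
  qed
  have s2: "s k i i + e k k k \<in> W" if "i \<noteq> k" for k i
  proof -
    have "D1 k i (e k k i) = s k i i + e k k k"
      using that by (intro vec3_eqI) (auto simp: D1_nth e_nth s_nth)
    then show ?thesis using D_closed(1)[OF W d[of i k], of k i] that by simp
  qed
  have NI: "x \<in> N" if "\<And>i j k. x $ (i, j, k) = x $ (j, i, k)" "\<And>i. tau x i = 0" for x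
    using that by (simp add: N_def mem_C_iff mem_T_iff)
  show "submod W" by (rule W)
  show "submod N" by (rule submod_N)
  fix l assume l: "l \<in> N" "l \<noteq> 0"
  let ?D = "{(i :: 'n, j, k). \<not> (i = j \<and> i = k)}"
  have sym: "l $ (i, j, k) = l $ (j, i, k)" and tau: "tau l i = 0" for i j k
    using l(1) unfolding N_def mem_C_iff mem_T_iff Int_iff by blast+
  show "\<exists>z\<in>W \<inter> N. \<exists>x\<in>?D. l $ x \<noteq> 0 \<and> z $ x = 1 \<and> (\<forall>y\<in>?D. z $ y \<noteq> 0 \<longrightarrow> l $ y \<noteq> 0)"
  proof -
    consider (distinct) i j k where "i \<noteq> j" "i \<noteq> k" "j \<noteq> k" "l $ (i, j, k) \<noteq> 0"
      | (square) i k where "i \<noteq> k" "l $ (k, k, i) \<noteq> 0"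
      | (mixed) k i where "i \<noteq> k" "l $ (k, i, i) \<noteq> 0"
      | (diag) "\<And>i j k. \<not> (i = j \<and> i = k) \<Longrightarrow> l $ (i, j, k) = 0"
    proof (cases "\<forall>i j k. \<not> (i = j \<and> i = k) \<longrightarrow> l $ (i, j, k) = 0")
      case True
      then show thesis using that(4) by blast
    next
      case False
      then obtain i j k where *: "\<not> (i = j \<and> i = k)" "l $ (i, j, k) \<noteq> 0" by blast
      consider "i = j" "i \<noteq> k" | "i \<noteq> j" "j = k" | "i \<noteq> j" "i = k" | "distinct [i, j, k]"
        using *(1) by auto
      then show thesis
        using that(1)[of i j k] that(2)[of k i] that(3)[of j i] that(3)[of i j] *(2) sym[of i j k]
        by cases auto
    qed
    then show ?thesis
    proof cases
      case (distinct i j k)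
      have "s i j k \<in> N" using distinct by (intro NI) (auto simp: s_nth tau_s)
      then have "s i j k \<in> W \<inter> N" using s3[of i j k] distinct by blast
      moreover have "l $ (j, i, k) \<noteq> 0" using sym[of i j k] distinct by simp
      ultimately show ?thesis
        using distinct
        by (intro bexI[of _ "s i j k"] bexI[of _ "(i, j, k)"]) (auto simp: s_nth split: if_splits)
    next
      case (square i k)
      have "e k k i \<in> N" using square by (intro NI) (auto simp: e_nth tau_e)
      then have "e k k i \<in> W \<inter> N" using d[of i k] square by blast
      then show ?thesis
        using square
        by (intro bexI[of _ "e k k i"] bexI[of _ "(k, k, i)"]) (auto simp: e_nth split: if_splits)
    next
      case (mixed k i)
      have "s k i i + e k k k \<in> N"
        using mixed by (intro NI) (auto simp: e_nth s_nth tau_add tau_s tau_e)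
      then have "s k i i + e k k k \<in> W \<inter> N" using s2[of i k] mixed by blast
      moreover have "l $ (i, k, i) \<noteq> 0" using sym[of i k i] mixed by simp
      ultimately show ?thesis
        using mixed
        by (intro bexI[of _ "s k i i + e k k k"] bexI[of _ "(k, i, i)"])
          (auto simp: s_nth e_nth split: if_splits)
    next
      case diag
      \<comment> \<open>With all other coordinates gone, \<open>tau l i\<close> consists of this one
        alone.\<close>
      have "l $ (i, i, i) = 0" for i
      proof -
        have "tau l i = (\<Sum>b\<in>UNIV. if b = i then l $ (i, i, i) else 0)"
          unfolding tau_def using diag by (intro sum.cong) auto
        then show ?thesis using tau[of i] by simp
      qed
      then have "l $ (i, j, k) = 0" for i j k using diag[of i j k] by (cases "i = j \<and> i = k") auto
      then have "l = 0" by (intro vec3_eqI) simp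
      then show ?thesis using l by simp
    qed
  qed
qed

text \<open>A vector of \<open>C\<close> outside \<open>K\<close> has some
  \<open>l $ (i, i, k)\<close> nonzero. If \<open>i\<close> and \<open>k\<close> differ,
  \<open>D3 i k\<close> isolates this scalar as a multiple of \<open>e k k i\<close>; otherwise
  \<open>D1\<close> first moves it to a coordinate with different indices.\<close>

lemma N_subset:
  assumes W: "submod W" and WC: "W \<subseteq> C" and WK: "\<not> W \<subseteq> K"
  shows "N \<subseteq> W"
proof -
  obtain l where l: "l \<in> W" "l \<in> C" "l \<notin> K" using WC WK by blast
  have *: "N \<subseteq> W" if "l \<in> W" "i \<noteq> k" "l $ (i, i, k) \<noteq> 0" for l i k
  proof (rule N_subset_if_square[OF W])
    have "D3 i k l = l $ (i, i, k) *s e k k i"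
      by (intro vec3_eqI) (auto simp: D3_nth e_nth)
    then have "e k k i = (1 / l $ (i, i, k)) *s D3 i k l"
      using that by (simp add: vec_eq_iff)
    then show "e k k i \<in> W"
      using submod_smult[OF W D_closed(3)[OF W that(1,2)], of "1 / l $ (i, i, k)"] by simp
  qed (use that in simp)
  obtain i k where ik: "l $ (i, i, k) \<noteq> 0" using l(2,3) by (auto simp: mem_K_iff)
  show ?thesis
  proof (cases "i = k")
    case False
    then show ?thesis using * l(1) ik by blast
  next
    case True
    obtain p where p: "p \<noteq> k" using ex_third by blast
    show ?thesis
    proof (cases "l $ (k, k, p) = 0")
      case False
      then show ?thesis using *[OF l(1), of k p] p by auto
    next
      case 0: True
      \<comment> \<open>The first two summands are equal by commutativity, so the diagonal
        coordinate survives alone.\<close>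
      have "D1 p k l $ (k, k, p) = l $ (p, k, p) + l $ (k, p, p) + l $ (k, k, k)"
        by (simp add: D1_nth)
      also have "l $ (p, k, p) = l $ (k, p, p)" using l(2) unfolding mem_C_iff by blast
      finally have "D1 p k l $ (k, k, p) \<noteq> 0" using ik True by simp
      then show ?thesis using *[OF D_closed(1)[OF W l(1) p], of k p] p by auto
    qed
  qed
qed

text \<open>A new index can enter only as the upper one (\<open>upper\<close>); \<open>swap\<close>
  and the symmetry then carry it to its place. The places are filled in the order \<open>i\<close>,
  \<open>j\<close>, \<open>k\<close>. In dimension 3 there are no new indices and permuting
  suffices.\<close>

lemma s_all:
  assumes W: "submod W" and abc: "s a b c \<in> W" "distinct [a, b, c]" and ijk: "distinct [i, j, k]"
  shows "s i j k \<in> W"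
proof -
  have sym: "s j i k \<in> W" if "s i j k \<in> W" for i j k
    using that by (simp add: s_commute)
  have swap: "s k j i \<in> W" if "s i j k \<in> W" "distinct [i, j, k]" for i j k
  proof -
    have "D2 i k (s i j k) = s k j i"
      using that by (intro vec3_eqI) (auto simp: D2_nth s_nth)
    then show ?thesis using D_closed(2)[OF W that(1), of i k] that(2) by simp
  qed
  have upper: "s i j p \<in> W" if "s i j k \<in> W" "distinct [i, j, k]" "p \<notin> {i, j, k}" for i j k p
  proof -
    have "D1 p k (s i j k) = s i j p"
      using that by (intro vec3_eqI) (auto simp: D1_nth s_nth)
    then show ?thesis using D_closed(1)[OF W that(1), of p k] that(3) by simp
  qed
  have "\<exists>b c. s i b c \<in> W \<and> distinct [i, b, c]"
  proof -
    consider "i = a" | "i = b" | "i = c" | "i \<notin> {a, b, c}" by blast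
    then show ?thesis
    proof cases
      case 4
      have "s i b a \<in> W" using swap[OF upper[OF abc 4]] 4 abc by auto
      then show ?thesis using abc 4 by (intro exI[of _ b] exI[of _ a]) auto
    next
      case 3
      then show ?thesis using abc swap[OF abc] by (intro exI[of _ b] exI[of _ a]) auto
    next
      case 2
      then show ?thesis using abc sym[OF abc(1)] by (intro exI[of _ a] exI[of _ c]) auto
    qed (use abc in blast)
  qed
  then obtain b c where bc: "s i b c \<in> W" "distinct [i, b, c]" by blast
  have swap': "s i c b \<in> W" if "s i b c \<in> W" "distinct [i, b, c]" for b c
    using sym[OF swap[OF sym[OF that(1)]]] that(2) by auto
  have "\<exists>c. s i j c \<in> W \<and> distinct [i, j, c]"
  proof -
    consider "j = b" | "j = c" | "j \<notin> {i, b, c}" using ijk by auto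
    then show ?thesis
    proof cases
      case 3
      have "s i j b \<in> W" using swap'[OF upper[OF bc 3]] 3 bc by auto
      then show ?thesis using bc 3 by (intro exI[of _ b]) auto
    next
      case 2
      then show ?thesis using bc swap'[OF bc] by (intro exI[of _ b]) auto
    qed (use bc in blast)
  qed
  then obtain c where "s i j c \<in> W" "distinct [i, j, c]" by blast
  then show ?thesis using upper[of i j c k] ijk by (cases "k = c") auto
qed

text \<open>\<open>U\<close> is spanned by the \<open>s i j k\<close> with distinct indices and the
  trace-free pairs \<open>s i j j + s i k k\<close>, which \<open>D1\<close> produces from the
  former.\<close>

lemma U_subset_if_s:
  assumes W: "submod W" and abc: "s a b c \<in> W" "distinct [a, b, c]"
  shows "U \<subseteq> W"
proof (rule subset_by_support[where D = UNIV])
  have s3: "s i j k \<in> W" if "distinct [i, j, k]" for i j k using s_all[OF W abc that] .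
  have s2: "s i j j + s i k k \<in> W" if "distinct [i, j, k]" for i j k
  proof -
    have "D1 j k (s j i k) = s i j j + s i k k"
      using that by (intro vec3_eqI) (auto simp: D1_nth s_nth)
    then show ?thesis using D_closed(1)[OF W s3[of j i k], of j k] that by auto
  qed
  have UI: "x \<in> U" if "\<And>i j k. x $ (i, j, k) = x $ (j, i, k)" "\<And>i k. x $ (i, i, k) = 0"
      "\<And>i. tau x i = 0" for x
    using that by (simp add: U_def mem_K_iff mem_C_iff mem_T_iff)
  show "submod W" by (rule W)
  show "submod U" by (rule submod_U)
  fix l assume l: "l \<in> U" "l \<noteq> 0"
  have sym: "l $ (i, j, k) = l $ (j, i, k)" and alt: "l $ (i, i, k) = 0" and tau: "tau l i = 0"
    for i j k
    using l(1) unfolding U_def mem_K_iff mem_C_iff mem_T_iff Int_iff by blast+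
  obtain i j k where ijk: "l $ (i, j, k) \<noteq> 0" using l(2) by (metis vec3_eqI zero_index)
  then have ij: "i \<noteq> j" using alt by auto
  consider (distinct) "distinct [i, j, k]" | (mixed) i j where "i \<noteq> j" "l $ (i, j, j) \<noteq> 0"
  proof (cases "distinct [i, j, k]")
    case False
    then have "k = i \<or> k = j" using ij by auto
    then show thesis using that(2)[of i j] that(2)[of j i] ij ijk sym[of i j k] by auto
  qed
  then show "\<exists>z\<in>W \<inter> U. \<exists>x\<in>UNIV. l $ x \<noteq> 0 \<and> z $ x = 1 \<and> (\<forall>y\<in>UNIV. z $ y \<noteq> 0 \<longrightarrow> l $ y \<noteq> 0)"
  proof cases
    case distinct
    have "s i j k \<in> U" using distinct by (intro UI) (auto simp: s_nth tau_s)
    then have "s i j k \<in> W \<inter> U" using s3[OF distinct] by blast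
    moreover have "l $ (j, i, k) \<noteq> 0" using sym[of i j k] ijk by simp
    ultimately show ?thesis
      using distinct ijk
      by (intro bexI[of _ "s i j k"] bexI[of _ "(i, j, k)"]) (auto simp: s_nth split: if_splits)
  next
    case (mixed i j)
    \<comment> \<open>Trace 0 forces a second nonzero term, the partner in the pair to be
      subtracted.\<close>
    have "\<exists>k. k \<noteq> j \<and> l $ (i, k, k) \<noteq> 0"
    proof (rule ccontr)
      assume *: "\<not> ?thesis"
      then have "tau l i = (\<Sum>b\<in>UNIV. if b = j then l $ (i, j, j) else 0)"
        unfolding tau_def by (intro sum.cong) auto
      then show False using tau[of i] mixed by simp
    qed
    then obtain k where k: "k \<noteq> j" "l $ (i, k, k) \<noteq> 0" by blast
    then have dist: "distinct [i, j, k]" using mixed alt by auto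
    then have "s i j j + s i k k \<in> U" by (intro UI) (auto simp: s_nth tau_s tau_add)
    then have "s i j j + s i k k \<in> W \<inter> U" using s2[OF dist] by blast
    moreover have "l $ (j, i, j) \<noteq> 0" "l $ (k, i, k) \<noteq> 0"
      using sym[of i j j] sym[of i k k] mixed k by simp_all
    ultimately show ?thesis
      using dist mixed k
      by (intro bexI[of _ "s i j j + s i k k"] bexI[of _ "(i, j, j)"])
        (auto simp: s_nth split: if_splits)
  qed
qed

text \<open>The common value of \<open>l $ (i, j, j)\<close> over all \<open>j\<close> other than
  \<open>i\<close> is the value of \<theta> at \<open>v i\<close>. The contrapositive tells which
  coordinates to look at outside \<open>Mstar11\<close>.\<close>

lemma mem_M_I:
  assumes l: "l \<in> K" and zero: "\<And>i j k. distinct [i, j, k] \<Longrightarrow> l $ (i, j, k) = 0"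
    and const: "\<And>i j k. distinct [i, j, k] \<Longrightarrow> l $ (i, j, j) = l $ (i, k, k)"
  shows "l \<in> Mstar11"
proof -
  have sym: "l $ (i, j, k) = l $ (j, i, k)" and alt: "l $ (i, i, k) = 0" for i j k
    using l unfolding mem_K_iff mem_C_iff by blast+
  \<comment> \<open>An arbitrary index other than \<open>i\<close>, at which the common value is
    read off.\<close>
  define o' where "o' = (\<lambda>i :: 'n. SOME j. j \<noteq> i)"
  have o': "o' i \<noteq> i" for i
    unfolding o'_def by (rule someI_ex) (use ex_third[of i i] in blast)
  define t where "t = (\<lambda>i. l $ (i, o' i, o' i))"
  have t: "l $ (i, j, j) = t i" if "j \<noteq> i" for i j
    using const[of i j "o' i"] o'[of i] that unfolding t_def by (cases "j = o' i") auto
  have "l = m11 t"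
  proof (rule vec3_eqI)
    fix i j k :: 'n
    consider "i = j" | "i \<noteq> j" "k = i" | "i \<noteq> j" "k = j" | "distinct [i, j, k]" by auto
    then show "l $ (i, j, k) = m11 t $ (i, j, k)"
      by cases (auto simp: m11_nth alt zero t sym[of i j i])
  qed
  then show ?thesis by (simp add: Mstar11_eq)
qed

text \<open>By \<open>mem_M_I\<close>, either a coordinate with distinct indices is nonzero or two
  values \<open>l $ (i, j, j)\<close> and \<open>l $ (i, k, k)\<close> differ; \<open>D1 j k\<close>
  turns the second case into the first.\<close>

lemma U_subset:
  assumes W: "submod W" and WK: "W \<subseteq> K" and WM: "\<not> W \<subseteq> Mstar11"
  shows "U \<subseteq> W"
proof -
  obtain l where l: "l \<in> W" "l \<in> K" "l \<notin> Mstar11" using WK WM by blast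
  have *: "U \<subseteq> W" if lW: "l \<in> W" and ijk: "distinct [i, j, k]" "l $ (i, j, k) \<noteq> 0" for l i j k
  proof (rule U_subset_if_s[OF W])
    have alt: "l $ (i, i, k) = 0" for i k using lW WK by (auto simp: mem_K_iff)
    have "l \<in> C" using lW WK K_subset_C by blast
    then have sym: "l $ (i, j, k) = l $ (j, i, k)" unfolding mem_C_iff by blast
    \<comment> \<open>\<open>D2 i k l\<close> only has products of \<open>v k\<close> with other
      basis vectors, all multiples of \<open>v i\<close>. Of these, \<open>D2 j i\<close> keeps just
      the product with \<open>v j\<close>, so a single scalar remains.\<close>
    have "D2 j i (D2 i k l) = l $ (i, j, k) *s s i k j"
    proof (rule vec3_eqI)
      fix a b c
      have "D2 i k l $ (j, j, c) = 0" for c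
        using ijk(1) by (simp add: D2_nth)
      moreover have "D2 i k l $ (j, b, i) = (if b = k then l $ (i, j, k) else 0)" for b
        using ijk(1) by (simp add: D2_nth sym)
      moreover have "D2 i k l $ (a, j, i) = (if a = k then l $ (i, j, k) else 0)" for a
        using ijk(1) by (simp add: D2_nth)
      ultimately have "D2 j i (D2 i k l) $ (a, b, c) =
          (if c = j \<and> a = i then if b = k then l $ (i, j, k) else 0 else 0)
          + (if c = j \<and> b = i then if a = k then l $ (i, j, k) else 0 else 0)"
        by (simp only: D2_nth[of j i] if_cancel add_0)
      then show "D2 j i (D2 i k l) $ (a, b, c) = (l $ (i, j, k) *s s i k j) $ (a, b, c)"
        using ijk(1) by (auto simp: s_nth)
    qed
    moreover have "D2 j i (D2 i k l) \<in> W"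
      using ijk(1) by (intro D_closed(2)[OF W] lW) auto
    ultimately have "(1 / l $ (i, j, k)) *s (l $ (i, j, k) *s s i k j) \<in> W"
      using submod_smult[OF W] by metis
    then show "s i k j \<in> W" using ijk(2) by (simp add: vector_smult_assoc)
    show "distinct [i, k, j]" using ijk by auto
  qed
  obtain i j k where ijk: "distinct [i, j, k]" "l $ (i, j, k) \<noteq> 0 \<or> l $ (i, j, j) \<noteq> l $ (i, k, k)"
    using mem_M_I[OF l(2)] l(3) by blast
  show ?thesis
  proof (cases "l $ (i, j, k) = 0 \<and> l $ (i, k, j) = 0")
    case False
    then show ?thesis using *[OF l(1), of i j k] *[OF l(1), of i k j] ijk(1) by auto
  next
    case True
    have "D1 j k l $ (i, k, j) = l $ (i, j, j) + l $ (i, k, k)"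
      using ijk by (simp add: D1_nth)
    then have "D1 j k l $ (i, k, j) \<noteq> 0"
      using ijk True by (simp flip: minus_eq)
    moreover have "D1 j k l \<in> W" using ijk(1) by (intro D_closed(1)[OF W l(1)]) auto
    ultimately show ?thesis using *[of "D1 j k l" i k j] ijk(1) by auto
  qed
qed

text \<open>\<open>Mstar11\<close> is a copy of the dual space: \<open>D1 p q\<close> sends \<theta>
  to its value at \<open>v p\<close> times the dual basis vector for \<open>q\<close>, so one
  nonzero value yields all of them.\<close>

lemma M_subset:
  assumes W: "submod W" and WM: "W \<subseteq> Mstar11" and W0: "W \<noteq> {0}"
  shows "Mstar11 \<subseteq> W"
proof -
  define u where "u = (\<lambda>q. m11 (\<lambda>j. if j = q then 1 else 0))"
  obtain l where l: "l \<in> W" "l \<noteq> 0" using W0 submod_0[OF W] by blast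
  then obtain t where t: "l = m11 t" using WM by (auto simp: Mstar11_eq)
  have "\<exists>p. t p \<noteq> 0"
  proof (rule ccontr)
    assume "\<not> ?thesis"
    then have "l = 0" unfolding t by (intro vec3_eqI) (simp add: m11_nth)
    then show False using l by simp
  qed
  then obtain p where p: "t p \<noteq> 0" by blast
  have move: "u q \<in> W" if "m11 t \<in> W" "t p \<noteq> 0" "p \<noteq> q" for t p q
  proof -
    have "D1 p q (m11 t) = t p *s u q"
      using that by (intro vec3_eqI) (auto simp: D1_nth m11_nth u_def)
    then have "(1 / t p) *s D1 p q (m11 t) = u q"
      using that by (simp add: vector_smult_assoc)
    then show ?thesis using submod_smult[OF W D_closed(1)[OF W that(1,3)]] by metis
  qed
  have u: "u q \<in> W" for q
  proof (cases "p = q")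
    case True
    \<comment> \<open>\<open>D1\<close> needs two different indices, so the dual basis vector for
      \<open>p\<close> itself is reached through a detour.\<close>
    obtain r where r: "r \<noteq> p" using ex_third by blast
    have "u r \<in> W" using move[of t p r] l t p r by auto
    then show ?thesis using move[of "\<lambda>j. if j = r then 1 else 0" r q] True r by (simp add: u_def)
  qed (use move[of t p q] l t p in auto)
  have expansion: "m11 t = (\<Sum>q\<in>UNIV. t q *s u q)" for t
    by (rule vec3_eqI) (simp add: u_def m11_nth distrib_left sum.distrib mult_delta_right)
  have "m11 t \<in> W" for t
    unfolding expansion[of t] by (intro submod_sum[OF W] submod_smult[OF W u])
  then show ?thesis by (auto simp: Mstar11_eq)
qed

text \<open>Modulo \<open>T\<close>, the module \<open>X\<close> embeds by \<open>tau\<close> into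
  the dual space. By \<open>tau_D1\<close> one nonzero trace in \<open>W\<close> produces every dual
  basis vector, so \<open>W\<close> meets every class of \<open>X\<close> modulo
  \<open>X \<inter> T\<close>.\<close>

lemma trace_generates:
  assumes W: "submod W" and X: "submod X" and WX: "W \<subseteq> X" and XT: "X \<inter> T \<subseteq> W"
    and WT: "\<not> W \<subseteq> T"
  shows "W = X"
proof
  obtain l p where l: "l \<in> W" and p: "tau l p \<noteq> 0" using WT unfolding mem_T_iff subset_iff by blast
  have move: "\<exists>w\<in>W. \<forall>j. tau w j = (if j = q then 1 else 0)"
    if "l \<in> W" "tau l p \<noteq> 0" "p \<noteq> q" for l p q
    using that submod_smult[OF W D_closed(1)[OF W that(1,3)], of "1 / tau l p"]
    by (intro bexI[of _ "(1 / tau l p) *s D1 p q l"]) (auto simp: tau_smult tau_D1)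
  have "\<exists>w\<in>W. \<forall>j. tau w j = (if j = q then 1 else 0)" for q
  proof (cases "p = q")
    case True
    obtain r where r: "r \<noteq> p" using ex_third by blast
    then obtain w where "w \<in> W" "tau w r = 1" using move[OF l p, of r] by auto
    then show ?thesis using move[of w r q] r True by auto
  qed (use move[OF l p] in auto)
  then obtain w where w: "\<And>q. w q \<in> W" "\<And>q j. tau (w q) j = (if j = q then 1 else 0)" by metis
  show "X \<subseteq> W"
  proof
    fix x assume x: "x \<in> X"
    \<comment> \<open>An element of \<open>W\<close> with the same traces as \<open>x\<close>; their
      sum is trace-free in characteristic 2.\<close>
    define y where "y = (\<Sum>q\<in>UNIV. tau x q *s w q)"
    have y: "y \<in> W" unfolding y_def by (intro submod_sum[OF W] submod_smult[OF W] w)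
    have tau_sum: "tau (sum f A) i = (\<Sum>a\<in>A. tau (f a) i)"
      for f :: "'n \<Rightarrow> 'f ^ ('n \<times> 'n \<times> 'n)" and A i
      by (induction A rule: infinite_finite_induct) (auto simp: tau_0 tau_add)
    have "tau y i = tau x i" for i
      unfolding y_def tau_sum by (simp add: tau_smult w mult_delta_right)
    then have "tau (x + y) i = 0" for i by (simp add: tau_add)
    then have "x + y \<in> T" by (simp add: mem_T_iff)
    moreover have "x + y \<in> X" using submod_add[OF X x] y WX by blast
    ultimately have "x + y \<in> W" using XT by blast
    then have "x + y - y \<in> W" by (rule submod_diff[OF W _ y])
    then show "x \<in> W" by simp
  qed
qed (rule WX)

lemma M_subset_K: "Mstar11 \<subseteq> K"
  by (auto simp: Mstar11_eq mem_K_iff mem_C_iff m11_nth add.commute)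

text \<open>Unless \<open>W\<close> lies in \<open>Mstar11\<close>, it contains \<open>U\<close> or
  \<open>N\<close>; whether it has a nonzero trace then decides between \<open>U\<close> and
  \<open>K\<close>, or between \<open>N\<close> and \<open>C\<close>.\<close>

lemma submodules_of_C:
  assumes W: "submod W" and WC: "W \<subseteq> C"
  shows "W \<in> {{0}, Mstar11, U, K, N, C}"
proof -
  consider "W \<subseteq> Mstar11" | "W \<subseteq> K" "\<not> W \<subseteq> Mstar11" | "\<not> W \<subseteq> K" by blast
  then show ?thesis
  proof cases
    case 1
    then show ?thesis using M_subset[OF W 1] by blast
  next
    case 2
    have UW: "U \<subseteq> W" by (rule U_subset[OF W 2])
    show ?thesis
    proof (cases "W \<subseteq> T")
      case True then show ?thesis using UW 2 by (auto simp: U_def)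
    next
      case False
      then show ?thesis using trace_generates[OF W submod_K 2(1)] UW by (simp add: U_def)
    qed
  next
    case 3
    have NW: "N \<subseteq> W" by (rule N_subset[OF W WC 3])
    show ?thesis
    proof (cases "W \<subseteq> T")
      case True then show ?thesis using NW WC by (auto simp: N_def)
    next
      case False
      then show ?thesis using trace_generates[OF W submod_C WC] NW by (simp add: N_def)
    qed
  qed
qed

subsection \<open>The lattice of submodules\<close>

lemma of_nat_eq: "(of_nat k :: 'f) = (if even k then 0 else 1)"
  by (induction k) auto

text \<open>The sum is (n+1) times \<open>t i\<close>. Every difference between odd and even
  dimension comes from here.\<close>

lemma tau_m11: "tau (m11 t) i = (if even CARD('n) then t i else 0)"
  by (simp add: tau_def m11_nth sum.distrib of_nat_eq)

text \<open>The same six submodules serve both parities; only the position of \<open>Mstar11\<close>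
  relative to \<open>U\<close> and \<open>N\<close> varies.\<close>

definition S :: "('f ^ ('n \<times> 'n \<times> 'n)) set set" where
  "S = {{0}, Mstar11, U, K, N, C}"

lemma mem_S_iff: "submod W \<and> W \<subseteq> C \<longleftrightarrow> W \<in> S"
proof
  have "submod {0}" using submod_Int[OF submod_U submod_M] submod_0
    by (auto simp: submod_def) (metis act_add add_cancel_right_right add_0)
  moreover assume "W \<in> S"
  ultimately show "submod W \<and> W \<subseteq> C"
    using submod_M submod_U submod_K submod_N submod_C M_subset_K K_subset_C submod_0[OF submod_C]
    unfolding S_def by (auto simp: U_def N_def)
qed (unfold S_def, use submodules_of_C in blast)

lemma zero_mem [simp]: "0 \<in> Mstar11" "0 \<in> U" "0 \<in> K" "0 \<in> N" "0 \<in> C"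
  using submod_0 submod_M submod_U submod_K submod_N submod_C by blast+

lemma subset_facts:
  "Mstar11 \<subseteq> K" "Mstar11 \<subseteq> C" "U \<subseteq> K" "U \<subseteq> N" "U \<subseteq> C" "K \<subseteq> C" "N \<subseteq> C"
  using M_subset_K K_subset_C by (auto simp: U_def N_def)

text \<open>These four give, by transitivity along \<open>subset_facts\<close>, all non-inclusions
  in \<open>S\<close> that are independent of parity.\<close>

lemma not_subset_basic: "\<not> Mstar11 \<subseteq> {0}" "\<not> U \<subseteq> Mstar11" "\<not> K \<subseteq> N" "\<not> N \<subseteq> K"
proof -
  obtain a b :: 'n where ab: "b \<noteq> a" using ex_third by blast
  obtain c where c: "c \<noteq> a" "c \<noteq> b" using ex_third by blast
  have "m11 (\<lambda>_. 1) $ (a, b, b) \<noteq> 0" using ab by (simp add: m11_nth)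
  then have "m11 (\<lambda>_. 1) \<noteq> 0" by (metis zero_index)
  then show "\<not> Mstar11 \<subseteq> {0}" by (auto simp: Mstar11_eq)
  have "s a b c \<in> U"
    using ab c by (auto simp: U_def mem_K_iff mem_C_iff mem_T_iff s_nth tau_s)
  moreover have "s a b c \<noteq> m11 t" for t
  proof
    assume "s a b c = m11 t"
    then have "s a b c $ (a, b, c) = m11 t $ (a, b, c)" by simp
    then show False using ab c by (auto simp: s_nth m11_nth)
  qed
  ultimately show "\<not> U \<subseteq> Mstar11" by (auto simp: Mstar11_eq)
  have "s a b b \<in> K" using ab by (auto simp: mem_K_iff mem_C_iff s_nth)
  moreover have "tau (s a b b) a \<noteq> 0" using ab by (simp add: tau_s)
  then have "s a b b \<notin> N" by (auto simp: N_def mem_T_iff)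
  ultimately show "\<not> K \<subseteq> N" by blast
  have "e a a b \<in> N" using ab by (auto simp: N_def mem_C_iff mem_T_iff e_nth tau_e)
  moreover have "e a a b $ (a, a, b) \<noteq> 0" by (simp add: e_nth)
  then have "e a a b \<notin> K" unfolding mem_K_iff by blast
  ultimately show "\<not> N \<subseteq> K" by blast
qed

lemma not_subset_facts:
  "\<not> U \<subseteq> {0}" "\<not> K \<subseteq> {0}" "\<not> N \<subseteq> {0}" "\<not> C \<subseteq> {0}"
  "\<not> K \<subseteq> Mstar11" "\<not> N \<subseteq> Mstar11" "\<not> C \<subseteq> Mstar11"
  "\<not> K \<subseteq> U" "\<not> N \<subseteq> U" "\<not> C \<subseteq> U" "\<not> C \<subseteq> K" "\<not> C \<subseteq> N"
  using not_subset_basic subset_facts zero_mem(1) by blast+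

lemma M_subset_N_iff: "Mstar11 \<subseteq> N \<longleftrightarrow> odd CARD('n)" and M_subset_U_iff: "Mstar11 \<subseteq> U \<longleftrightarrow> odd CARD('n)"
proof -
  have "Mstar11 \<subseteq> T \<longleftrightarrow> odd CARD('n)"
  proof
    show "Mstar11 \<subseteq> T" if "odd CARD('n)"
      using that by (auto simp: Mstar11_eq mem_T_iff tau_m11)
    assume "Mstar11 \<subseteq> T"
    then have "m11 (\<lambda>_. 1) \<in> T" by (auto simp: Mstar11_eq)
    then have "tau (m11 (\<lambda>_. 1)) i = 0" for i by (simp add: mem_T_iff)
    then show "odd CARD('n)" by (auto simp: tau_m11)
  qed
  then show "Mstar11 \<subseteq> N \<longleftrightarrow> odd CARD('n)" "Mstar11 \<subseteq> U \<longleftrightarrow> odd CARD('n)"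
    using subset_facts by (auto simp: U_def N_def)
qed

lemma distinct_facts:
  "{0} \<noteq> Mstar11" "{0} \<noteq> U" "{0} \<noteq> K" "{0} \<noteq> N" "{0} \<noteq> C" "Mstar11 \<noteq> U" "Mstar11 \<noteq> K" "Mstar11 \<noteq> N"
  "Mstar11 \<noteq> C" "U \<noteq> K" "U \<noteq> N" "U \<noteq> C" "K \<noteq> N" "K \<noteq> C" "N \<noteq> C"
  using not_subset_basic not_subset_facts by blast+

lemmas lattice_facts = subset_facts not_subset_basic not_subset_facts M_subset_N_iff M_subset_U_iff
  distinct_facts distinct_facts[symmetric]

section \<open>The covering relation and composition series\<close>

definition cover :: "('f ^ ('n \<times> 'n \<times> 'n)) set \<Rightarrow> ('f ^ ('n \<times> 'n \<times> 'n)) set \<Rightarrow> bool" where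
  "cover A B \<longleftrightarrow> A \<in> S \<and> B \<in> S \<and> A \<subseteq> B \<and> A \<noteq> B \<and> (\<forall>X\<in>S. A \<subseteq> X \<and> X \<subseteq> B \<longrightarrow> X = A \<or> X = B)"

lemma cover_iff_irreducible:
  assumes "A \<in> S" "B \<in> S"
  shows "cover A B \<longleftrightarrow> A \<subset> B \<and> gm_irreducible (gm_quotient (gm_restrict Lambda B) A)"
proof (cases "A \<subseteq> B")
  case True
  have "(submod X \<and> A \<subseteq> X \<and> X \<subseteq> B) \<longleftrightarrow> (X \<in> S \<and> A \<subseteq> X \<and> X \<subseteq> B)" for X
    using assms(2) mem_S_iff[of X] mem_S_iff[of B] by blast
  moreover have "submod A" "submod B" using assms mem_S_iff by blast+
  ultimately show ?thesis
    unfolding cover_def irreducible_quotient_iff[OF \<open>submod A\<close> \<open>submod B\<close> True]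
    using assms True by auto
qed (auto simp: cover_def)

lemma successively_cover_subset: "successively cover Ws \<Longrightarrow> Ws \<noteq> [] \<Longrightarrow> hd Ws \<in> S \<Longrightarrow> set Ws \<subseteq> S"
  by (induction Ws rule: induct_list012) (auto simp: cover_def)

text \<open>The saturated chains from \<open>A\<close> up to \<open>C\<close>, generalised in the
  starting point so that they can be computed from the top down.\<close>

definition paths :: "('f ^ ('n \<times> 'n \<times> 'n)) set \<Rightarrow> ('f ^ ('n \<times> 'n \<times> 'n)) set list set" where
  "paths A = {Ws. Ws \<noteq> [] \<and> hd Ws = A \<and> last Ws = C \<and> successively cover Ws}"

lemma composition_series_eq_paths:
  "{Ws. gm_composition_series (gm_restrict Lambda C) Ws} = paths {0}"
proof -
  have S0: "{0} \<in> S" by (simp add: S_def)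
  have "gm_composition_series (gm_restrict Lambda C) Ws \<longleftrightarrow>
      Ws \<noteq> [] \<and> hd Ws = {0} \<and> last Ws = C \<and> set Ws \<subseteq> S \<and> successively cover Ws" for Ws
  proof -
    have a: "(\<forall>i. Suc i < length Ws \<longrightarrow> Ws ! i \<subset> Ws ! Suc i \<and>
        gm_irreducible (gm_quotient (gm_restrict Lambda (Ws ! Suc i)) (Ws ! i)))
      \<longleftrightarrow> successively cover Ws" if "set Ws \<subseteq> S"
      unfolding successively_conv_nth
    proof (intro all_cong)
      fix i assume i: "Suc i < length Ws"
      then have "Ws ! i \<in> S" "Ws ! Suc i \<in> S" using that by (auto simp: subset_iff)
      then show "(Ws ! i \<subset> Ws ! Suc i \<and>
          gm_irreducible (gm_quotient (gm_restrict Lambda (Ws ! Suc i)) (Ws ! i)))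
        \<longleftrightarrow> cover (Ws ! i) (Ws ! Suc i)"
        using cover_iff_irreducible by blast
    qed
    have b: "(\<forall>W\<in>set Ws. gm_submodule (gm_restrict Lambda C) W) \<longleftrightarrow> set Ws \<subseteq> S"
      unfolding submodule_restrict mem_S_iff by blast
    show ?thesis
      unfolding gm_composition_series_def restrict_restrict b gm_restrict_simps Lambda_simps
      by (cases "set Ws \<subseteq> S") (simp_all only: a simp_thms)
  qed
  then show ?thesis
    unfolding paths_def using successively_cover_subset S0 by (intro Collect_cong) metis
qed

lemma paths_unfold:
  "paths A = (if A = C then {[C]} else {}) \<union> (\<Union>B\<in>{B. cover A B}. (#) A ` paths B)"
proof (intro set_eqI iffI)
  fix Ws assume Ws: "Ws \<in> paths A"
  then obtain Xs where Xs: "Ws = A # Xs" by (cases Ws) (auto simp: paths_def)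
  show "Ws \<in> (if A = C then {[C]} else {}) \<union> (\<Union>B\<in>{B. cover A B}. (#) A ` paths B)"
  proof (cases Xs)
    case Nil
    then show ?thesis using Ws Xs by (simp add: paths_def)
  next
    case (Cons B Ys)
    then have "cover A B" "Xs \<in> paths B" using Ws Xs by (auto simp: paths_def)
    then show ?thesis using Xs by blast
  qed
next
  fix Ws assume "Ws \<in> (if A = C then {[C]} else {}) \<union> (\<Union>B\<in>{B. cover A B}. (#) A ` paths B)"
  then consider "A = C" "Ws = [C]" | B Xs where "cover A B" "Xs \<in> paths B" "Ws = A # Xs"
    by (auto split: if_splits)
  then show "Ws \<in> paths A"
    by cases (auto simp: paths_def successively_Cons)
qed

text \<open>Restricts the upper module to the six elements of \<open>S\<close>, which turns each
  covering statement into a simplification over the inclusion table.\<close>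

lemma cover_eqI:
  assumes "\<forall>B\<in>S. cover A B \<longleftrightarrow> Q B" "\<And>B. Q B \<Longrightarrow> B \<in> S"
  shows "cover A B \<longleftrightarrow> Q B"
  using assms unfolding cover_def by blast

lemma cover_0: "cover {0} B \<longleftrightarrow> B = Mstar11 \<or> even CARD('n) \<and> B = U"
  by (rule cover_eqI) (simp add: S_def cover_def lattice_facts, auto simp: S_def)

lemma cover_M: "cover Mstar11 B \<longleftrightarrow> (if even CARD('n) then B = K else B = U)"
  by (rule cover_eqI) (simp_all add: S_def cover_def lattice_facts split: if_splits)

lemma cover_U: "cover U B \<longleftrightarrow> B = K \<or> B = N"
  by (rule cover_eqI) (simp add: S_def cover_def lattice_facts, auto simp: S_def)

lemma cover_K: "cover K B \<longleftrightarrow> B = C"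
  and cover_N: "cover N B \<longleftrightarrow> B = C"
  by (rule cover_eqI; simp add: S_def cover_def lattice_facts)+

lemma cover_C: "\<not> cover C B"
  by (simp add: cover_def S_def) (auto simp: lattice_facts)

lemma cover_C_iff: "cover W C \<longleftrightarrow> W = K \<or> W = N"
proof
  assume W: "cover W C"
  then have "W \<in> S" by (simp add: cover_def)
  moreover have "\<not> cover {0} C" "\<not> cover Mstar11 C" "\<not> cover U C"
    unfolding cover_0 cover_M cover_U using distinct_facts by auto
  ultimately show "W = K \<or> W = N" using W cover_C unfolding S_def by blast
qed (auto simp: cover_K cover_N)

lemma paths_C: "paths C = {[C]}"
  by (subst paths_unfold) (auto simp: cover_C)

lemma paths_K: "paths K = {[K, C]}"
  by (subst paths_unfold) (auto simp: cover_K paths_C distinct_facts)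

lemma paths_N: "paths N = {[N, C]}"
  by (subst paths_unfold) (auto simp: cover_N paths_C distinct_facts)

lemma paths_U: "paths U = {[U, K, C], [U, N, C]}"
  by (subst paths_unfold) (auto simp: cover_U paths_K paths_N distinct_facts)

lemma paths_M: "paths Mstar11 =
    (if even CARD('n) then {[Mstar11, K, C]} else {[Mstar11, U, K, C], [Mstar11, U, N, C]})"
  by (subst paths_unfold) (auto simp: cover_M paths_K paths_U distinct_facts)

lemma paths_0: "paths {0} =
    (if even CARD('n) then {[{0}, U, K, C], [{0}, Mstar11, K, C], [{0}, U, N, C]}
     else {[{0}, Mstar11, U, K, C], [{0}, Mstar11, U, N, C]})"
  by (subst paths_unfold) (auto simp: cover_0 paths_M paths_U distinct_facts)

section \<open>Maximal submodules, irreducible factors and the direct sum\<close>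

lemma maximal_submodules: "{W. gm_maximal_submodule (gm_restrict Lambda C) W} = {K, N}"
proof -
  have "gm_maximal_submodule (gm_restrict Lambda C) W \<longleftrightarrow> cover W C" for W
  proof -
    have "C \<in> S" by (simp add: S_def)
    then show ?thesis
      unfolding gm_maximal_submodule_def submodule_restrict mem_S_iff cover_def gm_restrict_simps
      using mem_S_iff by blast
  qed
  then show ?thesis by (auto simp: cover_C_iff)
qed

lemma irreducible_quotients:
  "gm_irreducible (gm_quotient (gm_restrict Lambda C) K)"
  "gm_irreducible (gm_quotient (gm_restrict Lambda N) U)"
  using cover_iff_irreducible[of K C] cover_iff_irreducible[of U N]
  by (simp_all add: S_def cover_K cover_U)

text \<open>Over the zero submodule the covering condition speaks of the module itself, so no
  passage to a quotient by 0 is made.\<close>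

lemma irreducible_if_cover_0:
  assumes "cover {0} B" shows "gm_irreducible (gm_restrict Lambda B)"
proof -
  have "W = {0} \<or> W = B" if "submod W" "W \<subseteq> B" for W
    using assms that mem_S_iff[of W] mem_S_iff[of B] submod_0[of W] unfolding cover_def by blast
  moreover have "B \<noteq> {0}" using assms by (auto simp: cover_def)
  ultimately show ?thesis by (simp add: gm_irreducible_def submodule_restrict)
qed

text \<open>For even n, \<open>tau\<close> maps \<open>Mstar11\<close> isomorphically onto all
  families of scalars, so \<open>Mstar11\<close> complements the kernel \<open>U\<close> of
  \<open>tau\<close> on \<open>K\<close>.\<close>

lemma direct_sum_K:
  assumes "even CARD('n)" shows "gm_direct_sum (gm_restrict Lambda K) U Mstar11"
proof -
  have "K \<subseteq> {a + b | a b. a \<in> U \<and> b \<in> Mstar11}"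
  proof
    fix x assume x: "x \<in> K"
    \<comment> \<open>The projection of \<open>x\<close> to \<open>Mstar11\<close>: by
      \<open>tau_m11\<close> it has the same traces as \<open>x\<close>.\<close>
    let ?m = "m11 (tau x)"
    have m: "?m \<in> Mstar11" by (simp add: Mstar11_eq)
    then have "x + ?m \<in> K" using x subset_facts(1) submod_add[OF submod_K] by blast
    then have "x + ?m \<in> U" by (simp add: U_def mem_T_iff tau_add tau_m11 assms)
    moreover have "x = (x + ?m) + ?m" by (rule vec3_eqI) (simp add: add.assoc)
    ultimately show "x \<in> {a + b | a b. a \<in> U \<and> b \<in> Mstar11}" using m by blast
  qed
  moreover have "{a + b | a b. a \<in> U \<and> b \<in> Mstar11} \<subseteq> K"
    using subset_facts submod_add[OF submod_K] by blast
  moreover have "U \<inter> Mstar11 \<subseteq> {0}"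
  proof
    fix x assume x: "x \<in> U \<inter> Mstar11"
    then obtain t where t: "x = m11 t" by (auto simp: Mstar11_eq)
    have "tau x i = 0" for i using x by (simp add: U_def mem_T_iff)
    then have "t i = 0" for i unfolding t by (simp add: tau_m11 assms)
    then show "x \<in> {0}" by (auto simp: t m11_nth intro: vec3_eqI)
  qed
  ultimately show ?thesis
    unfolding gm_direct_sum_def submodule_restrict
    using submod_U submod_M subset_facts by auto
qed

end

theorem mainTheorem3:
  fixes scale :: "'f::field \<Rightarrow> 'v::ab_group_add \<Rightarrow> 'v"
    and v :: "'n::finite \<Rightarrow> 'v"
  assumes "based_space scale v"
    and "infinite (UNIV :: 'f set) \<or> card (UNIV :: 'f set) > 2"
    and "CHAR('f) = 2"
    and "CARD('n) \<ge> 3"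
  shows
    "let \<Lambda> = based_space.Lambda scale v;
         C = based_space.C scale v;
         K = based_space.K scale v;
         U = based_space.U scale v;
         N = based_space.N scale v;
         M = based_space.Mstar11 scale v;
         \<C> = gm_restrict \<Lambda> C;
         \<K> = gm_restrict \<Lambda> K;
         \<N> = gm_restrict \<Lambda> N
     in
       ({W. gm_maximal_submodule \<C> W} = {K, N} \<and> K \<noteq> N \<and>
        gm_irreducible (gm_quotient \<C> K) \<and> gm_irreducible (gm_quotient \<N> U)) \<and>
       (odd CARD('n) \<longrightarrow>
          {Ws. gm_composition_series \<C> Ws} = {[{0}, M, U, K, C], [{0}, M, U, N, C]} \<and>
          card {Ws. gm_composition_series \<C> Ws} = 2) \<and>
       (even CARD('n) \<longrightarrow>
          gm_direct_sum \<K> U M \<and>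
          gm_irreducible (gm_restrict \<Lambda> U) \<and> gm_irreducible (gm_restrict \<Lambda> M) \<and>
          {Ws. gm_composition_series \<C> Ws} =
            {[{0}, U, K, C], [{0}, M, K, C], [{0}, U, N, C]} \<and>
          card {Ws. gm_composition_series \<C> Ws} = 3)"
proof -
  have "\<exists>t :: 'f. t \<noteq> 0 \<and> t \<noteq> 1"
  proof (rule ccontr)
    assume "\<not> ?thesis"
    then have U: "(UNIV :: 'f set) = {0, 1}" by auto
    then have "finite (UNIV :: 'f set)" by (metis finite.emptyI finite_insert)
    moreover have "card (UNIV :: 'f set) \<le> 2" unfolding U by (simp add: card_insert_if)
    ultimately show False using assms(2) by simp
  qed
  moreover have "(2 :: 'f) = 0" using of_nat_CHAR[where 'a = 'f] by (simp add: assms(3))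
  ultimately interpret char_2_space scale v
    using assms(1,4) by (intro char_2_space.intro char_2_space_axioms.intro)
  \<comment> \<open>The listed series are pairwise different by \<open>distinct_facts\<close>, which
    gives the cardinalities 2 and 3.\<close>
  show ?thesis
    unfolding Let_def composition_series_eq_paths paths_0
    using maximal_submodules irreducible_quotients direct_sum_K
    by (auto simp: distinct_facts distinct_facts[symmetric] cover_0 intro: irreducible_if_cover_0)
qed

end
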